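(* Let $\eta$ be a nonzero complex number and let $a$ be a nonzero finite complex number. Then there is no non-constant entire function $f(z)$ of finite order such that $f(z)$ and $\Delta_{\eta}f(z)=f(z+\eta)-f(z)$ share the pairs $(0,0)$ and $(a,-a)$ IM.
   Context: For complex numbers $c,d$, two non-constant meromorphic functions $f$ and $g$ are said to share the pair $(c,d)$ IM if $f-c$ and $g-d$ have the same zeros, ignoring multiplicities. The order of a meromorphic function $f$ is $\rho(f)=\limsup_{r\to\infty}\frac{\log^{+}T(r,f)}{\log r}$, where $T(r,f)$ is the Nevanlinna characteristic function. *)

theory Defs
  imports "HOL-Complex_Analysis.Complex_Analysis"
begin

definition log_plus :: "real \<Rightarrow> real" where
  "log_plus x = max 0 (ln x)"

definition proximity :: "(complex \<Rightarrow> complex) \<Rightarrow> real \<Rightarrow> real" where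
  "proximity f r = (1 / (2 * pi)) *
     integral {0..2*pi} (\<lambda>\<theta>. log_plus (cmod (f (of_real r * cis \<theta>))))"

text \<open>Nevanlinna characteristic T(r,f) = m(r,f) + N(r,f) of an entire function:
  an entire function has no poles, so the integrated counting function of poles
  N(r,f) vanishes identically and T(r,f) = m(r,f).\<close>
definition nevanlinna_T_entire :: "real \<Rightarrow> (complex \<Rightarrow> complex) \<Rightarrow> real" where
  "nevanlinna_T_entire r f = proximity f r"

definition order_entire :: "(complex \<Rightarrow> complex) \<Rightarrow> ereal" where
  "order_entire f = Limsup at_top
     (\<lambda>r. ereal (log_plus (nevanlinna_T_entire r f) / ln r))"

definition nonconstant :: "(complex \<Rightarrow> complex) \<Rightarrow> bool" where
  "nonconstant f \<longleftrightarrow> \<not> (\<exists>c. \<forall>z. f z = c)"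

definition share_pair_IM ::
  "(complex \<Rightarrow> complex) \<Rightarrow> (complex \<Rightarrow> complex) \<Rightarrow> complex \<Rightarrow> complex \<Rightarrow> bool" where
  "share_pair_IM f g c d \<longleftrightarrow> nonconstant f \<and> nonconstant g \<and>
     {z. f z = c} = {z. g z = d}"

definition diff_op :: "complex \<Rightarrow> (complex \<Rightarrow> complex) \<Rightarrow> complex \<Rightarrow> complex" where
  "diff_op \<eta> f z = f (z + \<eta>) - f z"

end

theory Submission
  imports Defs
begin

text \<open>Put \<open>F = f - a\<close>, \<open>g z = f (z + \<eta>) - f z\<close> and \<open>G = g + a\<close>, so that \<open>f (z + \<eta>) = F z + G z\<close>, and let
  \<open>log |f z| = O(|z|\<^sup>s)\<close>. By the sharing hypotheses every zero and every \<open>a\<close>-point of \<open>f\<close> is followed, at distance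
  \<open>\<eta>\<close>, by a zero. Hence \<open>\<phi> z = f' z f (z + \<eta>) / (f z F z)\<close> is entire, and, since each \<open>a\<close>-point starts a chain of
  zeros of its own, there are only \<open>O(R powr (s - 1))\<close> distinct \<open>a\<close>-points in a disc of radius \<open>R\<close>. On
  suitable circles the quotients \<open>u = F' / F\<close>, \<open>v = G' / G\<close> and \<open>f (z + \<eta>) / f z\<close> have logarithms of order
  \<open>R powr (s - 1) log R\<close>. For \<open>s < 1\<close> this gives \<open>\<phi> = 0\<close>, which is absurd. For \<open>s \<ge> 1\<close>, differentiating the
  relation \<open>u G = (\<phi> - u) F + a \<phi>\<close> and eliminating \<open>G\<close> expresses \<open>F\<close> as a quotient of polynomials in
  \<open>u, v, \<phi>\<close> and their derivatives, all meromorphic with few poles and of lower growth; so \<open>s\<close> can be lowered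
  by \<open>1/2\<close>. If the denominator vanishes identically, then \<open>\<phi>\<close> is a constant multiple of \<open>u G\<close> and the
  undifferentiated relation already expresses \<open>F\<close> in this way.\<close>

subsection \<open>Local factorization of holomorphic functions\<close>

text \<open>Away from the zeros of f, a shift by the fixed amount \<open>\<eta>\<close> changes log
  |f| like a logarithmic derivative: one power of R is gained over log |f| itself, and only the
  choice of the circles adds the factor log R. The obstacle is that sharing ignores multiplicities,
  so that F / G may have zeros and poles and is not controlled. Logarithmic derivatives have simple
  poles whatever the multiplicities; hence the use of \<open>u\<close> and \<open>v\<close>. The
  function \<open>\<phi>\<close> is built on the same principle: f' / (f F) has at most simple
  poles, and f (z + \<eta>) vanishes at all of them. The poles of \<open>u\<close> and
  \<open>v\<close> are cleared by a product with one factor for each distinct a-point. Each factor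
  has logarithm of order log R, so a count of order R^(s - 1) is just what keeps the product within
  the same bound. The estimates are normalised at 0, where the functions involved must not vanish; a
  translation to a generic point provides this. The amount 1/2 is a convenient choice below 1: it
  leaves room for log R, and from an integer exponent it leads down to 1/2, where R^(s - 1) log R
  tends to 0.\<close>

text \<open>The Moebius map taking x to x / (2 B - x) fixes 0 and sends the half-plane Re x < B into
  the unit disc, so the Schwarz lemma applies to \<open>k\<close>; solving |k w| \<le> |w| for |x w|
  gives the bound.\<close>

lemma borel_caratheodory:
  fixes h :: "complex \<Rightarrow> complex"
  assumes holo: "h holomorphic_on ball 0 R" and Re_less: "\<And>w. w \<in> ball 0 R \<Longrightarrow> Re (h w) < A"
    and z: "norm z < R"
  shows "norm (h z - h 0) * (R - norm z) \<le> 2 * norm z * (A - Re (h 0))"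
proof -
  have R: "0 < R" using z by (meson norm_ge_zero le_less_trans)
  define B where "B = A - Re (h 0)"
  have B: "0 < B" using Re_less[of 0] R by (simp add: B_def)
  define x where "x = (\<lambda>w. h (of_real R * w) - h 0)"
  define k where "k = (\<lambda>w. x w / (2 * of_real B - x w))"
  have x_lt: "norm (x w) < norm (2 * of_real B - x w)" if "norm w < 1" for w
  proof -
    have "Re (x w) < B"
      using Re_less[of "of_real R * w"] R that by (simp add: x_def B_def norm_mult)
    then have "4 * B * Re (x w) < 4 * B * B"
      using B by simp
    then have "(norm (x w))\<^sup>2 < (norm (2 * of_real B - x w))\<^sup>2"
      unfolding cmod_power2 by (simp add: power2_eq_square algebra_simps)
    then show ?thesis
      using norm_ge_zero power2_less_imp_less by blast
  qed
  have "x holomorphic_on ball 0 1"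
    unfolding x_def using R
    by (intro holomorphic_intros holomorphic_on_compose_gen[OF _ holo, unfolded o_def])
       (auto simp: norm_mult)
  then have "k holomorphic_on ball 0 1"
    unfolding k_def using x_lt by (intro holomorphic_intros) force+
  moreover have "k 0 = 0" by (simp add: k_def x_def)
  moreover have "norm (k w) < 1" if "norm w < 1" for w
    using x_lt[OF that] by (simp add: k_def norm_divide divide_simps)
  ultimately have k_le: "norm (k w) \<le> norm w" if "norm w < 1" for w
    using Schwarz_Lemma(1)[of k w] that by blast
  define w where "w = z / of_real R"
  have w: "norm w < 1" using z R by (simp add: w_def norm_divide)
  have "norm (x w) = norm (k w) * norm (2 * of_real B - x w)"
    using x_lt[OF w] by (auto simp: k_def norm_divide)
  also have "\<dots> \<le> norm w * (2 * B + norm (x w))"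
    using k_le[OF w] norm_triangle_ineq4[of "2 * of_real B" "x w"] B
    by (intro mult_mono) (auto simp: norm_mult)
  finally have "R * norm (x w) \<le> R * (norm w * (2 * B + norm (x w)))"
    using R by (simp add: mult_left_mono)
  moreover have "R * (norm w * (2 * B + norm (x w))) = norm z * (2 * B + norm (x w))"
    using R by (simp add: w_def norm_divide)
  moreover have "x w = h z - h 0"
    using R by (simp add: x_def w_def)
  ultimately show ?thesis
    by (simp add: B_def algebra_simps)
qed

text \<open>Induction on the number of distinct zeros in \<open>K\<close>: one step divides out a
  zero with its whole multiplicity. Thus \<open>zs\<close> lists zeros with multiplicity, and
  \<open>length zs\<close> is the count that Jensen-type estimates need.\<close>

lemma holomorphic_factor_zeros:
  fixes f :: "complex \<Rightarrow> complex"
  assumes "f holomorphic_on S" "open S" "connected S" "compact K" "K \<subseteq> S" "z0 \<in> S" "f z0 \<noteq> 0"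
  obtains zs g where "set zs = {z \<in> K. f z = 0}" "g holomorphic_on S"
    "\<And>z. z \<in> S \<Longrightarrow> f z = prod_list (map (\<lambda>w. z - w) zs) * g z" "\<And>z. z \<in> K \<Longrightarrow> g z \<noteq> 0"
proof -
  have fin: "finite {z \<in> K. f z = 0}" if f: "f holomorphic_on S" "f z0 \<noteq> 0" for f
  proof (cases "f constant_on S")
    case True
    then have "{z \<in> K. f z = 0} = {}"
      using f \<open>z0 \<in> S\<close> \<open>K \<subseteq> S\<close> by (auto simp: constant_on_def)
    then show ?thesis by (metis finite.emptyI)
  next
    case False
    show ?thesis
      using holomorphic_compact_finite_zeros[OF f(1) assms(2-5) False] .
  qed
  have "\<exists>zs g. set zs = {z \<in> K. f z = 0} \<and> g holomorphic_on S \<and>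
          (\<forall>z\<in>S. f z = prod_list (map (\<lambda>w. z - w) zs) * g z) \<and> (\<forall>z\<in>K. g z \<noteq> 0)"
    using assms(1,7)
  proof (induction "card {z \<in> K. f z = 0}" arbitrary: f)
    case 0
    then have "{z \<in> K. f z = 0} = {}" using fin by auto
    then show ?case using 0 by (intro exI[of _ "[]"] exI[of _ f]) auto
  next
    case (Suc m)
    then obtain p where p: "p \<in> K" "f p = 0"
      by (metis (mono_tags, lifting) Collect_empty_eq card.empty nat.distinct(1))
    have pS: "p \<in> S" using p assms by auto
    have nc: "\<not> f constant_on S"
      using p(2) pS Suc.prems(2) \<open>z0 \<in> S\<close> by (metis constant_on_def)
    obtain k r n where k: "0 < n" "0 < r" "ball p r \<subseteq> S" "k holomorphic_on ball p r"
      "\<And>w. w \<in> ball p r \<Longrightarrow> f w = (w - p) ^ n * k w" "\<And>w. w \<in> ball p r \<Longrightarrow> k w \<noteq> 0"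
      using holomorphic_factor_zero_nonconstant[OF Suc.prems(1) assms(2,3) pS p(2) nc] by metis
    define f' where "f' = (\<lambda>z. if z = p then k p else f z / (z - p) ^ n)"
    have f'k: "f' w = k w" if "w \<in> ball p r" for w
      using k(5)[OF that] by (simp add: f'_def)
    have "f' holomorphic_on ball p r \<union> (S - {p})"
    proof (intro holomorphic_on_Un)
      show "f' holomorphic_on ball p r"
        using k(4) f'k by (metis holomorphic_transform)
      have "(\<lambda>z. f z / (z - p) ^ n) holomorphic_on S - {p}"
        by (intro holomorphic_intros holomorphic_on_subset[OF Suc.prems(1)]) auto
      then show "f' holomorphic_on S - {p}"
        by (rule holomorphic_transform) (auto simp: f'_def)
    qed (use \<open>open S\<close> in auto)
    moreover have "ball p r \<union> (S - {p}) = S" using k pS by auto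
    ultimately have f': "f' holomorphic_on S" by simp
    have eq: "f z = (z - p) ^ n * f' z" if "z \<in> S" for z
      using p(2) k(1) by (auto simp: f'_def)
    have f'p: "f' p \<noteq> 0" using k(2,6) f'k[of p] by auto
    have "f' z0 \<noteq> 0" using eq[OF \<open>z0 \<in> S\<close>] Suc.prems(2) by auto
    have Z: "{z \<in> K. f z = 0} = insert p {z \<in> K. f' z = 0}"
      using eq k(1) p \<open>K \<subseteq> S\<close> by auto
    have "m = card {z \<in> K. f' z = 0}"
      using Suc.hyps(2) fin[OF f' \<open>f' z0 \<noteq> 0\<close>] f'p unfolding Z by simp
    from Suc.hyps(1)[OF this f' \<open>f' z0 \<noteq> 0\<close>]
    obtain zs g where g: "set zs = {z \<in> K. f' z = 0}" "g holomorphic_on S"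
      "\<forall>z\<in>S. f' z = prod_list (map (\<lambda>w. z - w) zs) * g z" "\<forall>z\<in>K. g z \<noteq> 0"
      by blast
    show ?case
      using g k(1) eq unfolding Z
      by (intro exI[of _ "replicate n p @ zs"] exI[of _ g]) (auto simp: prod_list_replicate)
  qed
  then show ?thesis using that by blast
qed

lemma norm_prod_list: "norm (prod_list (map f xs)) = prod_list (map (\<lambda>x. norm (f x)) xs)"
  for f :: "'a \<Rightarrow> complex"
  by (induction xs) (auto simp: norm_mult)

lemma prod_list_ge_power:
  fixes f :: "'a \<Rightarrow> real"
  assumes "0 \<le> c" "\<And>x. x \<in> set xs \<Longrightarrow> c \<le> f x"
  shows "c ^ length xs \<le> prod_list (map f xs)"
  using assms(2) by (induction xs) (auto intro!: mult_mono prod_list_nonneg simp: assms(1) intro: order_trans[OF assms(1)])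

lemma prod_list_le_power:
  fixes f :: "'a \<Rightarrow> real"
  assumes "\<And>x. x \<in> set xs \<Longrightarrow> 0 \<le> f x \<and> f x \<le> c"
  shows "prod_list (map f xs) \<le> c ^ length xs"
  using assms by (induction xs) (auto intro!: mult_mono prod_list_nonneg intro: order_trans)

lemma maximum_modulus_cball:
  fixes f :: "complex \<Rightarrow> complex"
  assumes "f holomorphic_on S" "cball 0 r \<subseteq> S" "0 < r" "\<And>z. norm z = r \<Longrightarrow> norm (f z) \<le> B" "norm z \<le> r"
  shows "norm (f z) \<le> B"
proof (rule maximum_modulus_frontier[of f "cball 0 r"])
  show "f holomorphic_on interior (cball 0 r)"
    using assms(1,2) by (meson holomorphic_on_subset interior_subset order_trans)
  show "continuous_on (closure (cball 0 r)) f"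
    using assms(1,2) by (metis closed_cball closure_closed continuous_on_subset holomorphic_on_imp_continuous_on)
qed (use assms in auto)

text \<open>The number of zeros enters the bounds for \<open>g\<close> with the right power of \<open>\<rho>\<close>: the factors
  of size at least \<open>2\<rho>\<close> on the circle of radius \<open>3\<rho>\<close>, compared to at most \<open>\<rho>\<close> at the centre,
  are what makes the Harnack-type bound for \<open>h\<close> free of logarithms.\<close>
lemma zero_exp_factorization:
  fixes f :: "complex \<Rightarrow> complex"
  assumes f: "f holomorphic_on ball 0 (4 * \<rho>)" and \<rho>: "0 < \<rho>"
    and M: "\<And>z. norm z < 4 * \<rho> \<Longrightarrow> norm (f z) \<le> M" and f0: "f 0 \<noteq> 0" and L: "ln (M / norm (f 0)) < L"
  obtains zs g h where "set zs = {z \<in> cball 0 \<rho>. f z = 0}" "g holomorphic_on ball 0 (4 * \<rho>)"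
    "\<And>z. norm z < 4 * \<rho> \<Longrightarrow> f z = prod_list (map (\<lambda>w. z - w) zs) * g z"
    "real (length zs) \<le> 2 * L" "h holomorphic_on ball 0 \<rho>" "\<And>z. norm z < \<rho> \<Longrightarrow> g z = exp (h z)"
    "\<And>z. norm z \<le> 7 / 8 * \<rho> \<Longrightarrow> norm (h z - h 0) \<le> 14 * L"
    "norm (f 0) \<le> \<rho> ^ length zs * norm (g 0)" "0 < L"
proof -
  obtain zs g where zs: "set zs = {z \<in> cball 0 \<rho>. f z = 0}" and g: "g holomorphic_on ball 0 (4 * \<rho>)"
    and fac: "\<And>z. z \<in> ball 0 (4 * \<rho>) \<Longrightarrow> f z = prod_list (map (\<lambda>w. z - w) zs) * g z"
    and gnz: "\<And>z. z \<in> cball 0 \<rho> \<Longrightarrow> g z \<noteq> 0"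
    by (rule holomorphic_factor_zeros[OF f, of "cball 0 \<rho>" 0]) (use \<rho> f0 in auto)
  define n where "n = length zs"
  have f0': "0 < norm (f 0)" using f0 by simp
  have "1 \<le> M / norm (f 0)" using M[of 0] \<rho> f0' by simp
  then have Lpos: "0 < L" using L ln_ge_zero[of "M / norm (f 0)"] by linarith
  have Mpos: "norm (f 0) \<le> M" using M[of 0] \<rho> by simp
  then have M0: "0 < M" using f0' by linarith
  have g_le: "norm (g z) \<le> M / (2 * \<rho>) ^ n" if "norm z \<le> 3 * \<rho>" for z
  proof (rule maximum_modulus_cball[OF g, of "3 * \<rho>"])
    fix w :: complex assume w: "norm w = 3 * \<rho>"
    have "(2 * \<rho>) ^ n \<le> prod_list (map (\<lambda>v. norm (w - v)) zs)"
      unfolding n_def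
    proof (rule prod_list_ge_power)
      fix v assume "v \<in> set zs"
      then have "norm v \<le> \<rho>" by (auto simp: zs)
      then show "2 * \<rho> \<le> norm (w - v)" using w norm_triangle_ineq2[of w v] by linarith
    qed (use \<rho> in auto)
    then have "(2 * \<rho>) ^ n * norm (g w) \<le> norm (f w)"
      using fac[of w] w \<rho> by (simp add: norm_mult norm_prod_list mult_right_mono)
    also have "\<dots> \<le> M" using M w \<rho> by simp
    finally show "norm (g w) \<le> M / (2 * \<rho>) ^ n" using \<rho> by (simp add: field_simps)
  qed (use \<rho> that in auto)
  have "prod_list (map (\<lambda>v. norm (0 - v)) zs) \<le> \<rho> ^ n"
    unfolding n_def using zs by (intro prod_list_le_power) auto
  then have f0_le: "norm (f 0) \<le> \<rho> ^ n * norm (g 0)"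
    using fac[of 0] \<rho> by (simp add: norm_mult norm_prod_list mult_right_mono)
  also have "\<dots> \<le> \<rho> ^ n * (M / (2 * \<rho>) ^ n)"
    using g_le[of 0] \<rho> by (intro mult_left_mono) auto
  also have "\<dots> = M / 2 ^ n" using \<rho> by (simp add: power_mult_distrib)
  \<comment> \<open>Each zero in the disc costs a factor 2 between the centre and the circle of
    radius 3 \<rho>. This is Jensen's count; the estimate 1/2 \<le> ln 2 turns it into n \<le> 2
    L.\<close>
  finally have "2 ^ n \<le> M / norm (f 0)" using f0' by (simp add: field_simps)
  then have "ln (2 ^ n) \<le> ln (M / norm (f 0))" by (rule ln_mono) simp
  moreover have "ln (2 ^ n) = n * ln 2" by (simp add: ln_realpow)
  moreover have "1 / 2 \<le> ln (2::real)" using ln2_ge_two_thirds by simp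
  ultimately have "n * (1/2) \<le> L"
    using L mult_left_mono[of "1 / 2" "ln 2" "real n"] by linarith
  then have nL: "real n \<le> 2 * L" by simp
  obtain h where h: "h holomorphic_on ball 0 \<rho>" "\<And>z. z \<in> ball 0 \<rho> \<Longrightarrow> exp (h z) = g z"
    by (rule holomorphic_logarithm_exists[of "ball 0 \<rho>" g 0])
       (use \<rho> gnz in \<open>auto intro: holomorphic_on_subset[OF g]\<close>)
  have Re_h: "Re (h z) = ln (norm (g z))" if "norm z < \<rho>" for z
    using h(2)[of z] that by (metis ln_exp mem_ball_0 norm_exp_eq_Re)
  have h_le: "norm (h z - h 0) \<le> 14 * L" if z: "norm z \<le> 7 / 8 * \<rho>" for z
  proof -
    define A where "A = ln (norm (g 0)) + L"
    have "Re (h w) < A" if "w \<in> ball 0 \<rho>" for w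
    proof -
      have gw: "0 < norm (g w)" "0 < norm (g 0)" using gnz that \<rho> by auto
      \<comment> \<open>The powers of \<open>\<rho>\<close> in the lower bound for
        \<open>g 0\<close> and in the upper bound for \<open>g w\<close> cancel, so that the
        oscillation of log |g| is at most log (M / |f 0|).\<close>
      have "norm (f 0) * norm (g w) \<le> (\<rho> ^ n * norm (g 0)) * (M / (2 * \<rho>) ^ n)"
        using f0_le g_le[of w] that \<rho> by (intro mult_mono) auto
      also have "\<dots> = norm (g 0) * M / 2 ^ n" using \<rho> by (simp add: power_mult_distrib)
      also have "\<dots> \<le> norm (g 0) * M"
        using order_trans[OF norm_ge_zero Mpos] mult_left_mono[of 1 "2 ^ n" "norm (g 0) * M"]
        by (simp add: divide_le_eq)
      finally have "norm (g w) \<le> norm (g 0) * (M / norm (f 0))"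
        using f0' by (simp add: field_simps)
      then have "ln (norm (g w)) \<le> ln (norm (g 0) * (M / norm (f 0)))"
        using gw by (intro ln_mono) auto
      also have "\<dots> = ln (norm (g 0)) + ln (M / norm (f 0))"
        using gw f0' M0 by (intro ln_mult_pos) auto
      finally show ?thesis using L Re_h[of w] that by (simp add: A_def)
    qed
    from borel_caratheodory[OF h(1) this, of z]
    have "norm (h z - h 0) * (\<rho> - norm z) \<le> 2 * norm z * (A - Re (h 0))"
      using z \<rho> by simp
    also have "A - Re (h 0) = L" using Re_h[of 0] \<rho> by (simp add: A_def)
    \<comment> \<open>The constant 14 is 2 (7/8) / (1/8), from |z| \<le> 7/8 \<rho> and the
      remaining distance \<rho> / 8 to the boundary.\<close>
    also have "2 * norm z * L \<le> (14 * L) * (\<rho> / 8)"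
      using mult_right_mono[OF z, of L] Lpos by (simp add: field_simps)
    finally have "norm (h z - h 0) * (\<rho> - norm z) \<le> (14 * L) * (\<rho> / 8)" .
    moreover have "norm (h z - h 0) * (\<rho> / 8) \<le> norm (h z - h 0) * (\<rho> - norm z)"
      using z by (intro mult_left_mono) auto
    ultimately have "norm (h z - h 0) * (\<rho> / 8) \<le> (14 * L) * (\<rho> / 8)" by linarith
    then show ?thesis using \<rho> by simp
  qed
  show ?thesis
    by (rule that[OF zs g]) (use fac nL h h_le f0_le Lpos in \<open>auto simp: n_def\<close>)
qed

text \<open>The quotient X / Y cannot be bounded directly near zeros of \<open>Y\<close>. With Y =
  (product over its zeros) g, the function q g equals X divided by that product and is bounded by
  the maximum principle from the circle of radius 3 \<rho>; afterwards the zero-free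
  \<open>g\<close>, which is at least |g 0| exp (- 14 L), is divided out. The comparison of M with
  |Y 0| adds one more L.\<close>

lemma norm_quotient_le:
  fixes q X Y :: "complex \<Rightarrow> complex"
  assumes X: "X holomorphic_on ball 0 (4 * \<rho>)" and Y: "Y holomorphic_on ball 0 (4 * \<rho>)"
    and q: "q holomorphic_on ball 0 (4 * \<rho>)" and eq: "\<And>z. norm z < 4 * \<rho> \<Longrightarrow> X z = q z * Y z"
    and \<rho>: "0 < \<rho>" and MX: "\<And>z. norm z < 4 * \<rho> \<Longrightarrow> norm (X z) \<le> M"
    and MY: "\<And>z. norm z < 4 * \<rho> \<Longrightarrow> norm (Y z) \<le> M"
    and Y0: "Y 0 \<noteq> 0" and L: "ln (M / norm (Y 0)) < L" and z: "norm z \<le> 7 / 8 * \<rho>"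
  shows "norm (q z) \<le> exp (15 * L)"
proof -
  obtain zs g h where zs: "set zs = {z \<in> cball 0 \<rho>. Y z = 0}" and g: "g holomorphic_on ball 0 (4 * \<rho>)"
    and fac: "\<And>z. norm z < 4 * \<rho> \<Longrightarrow> Y z = prod_list (map (\<lambda>w. z - w) zs) * g z"
    and "real (length zs) \<le> 2 * L" and h: "h holomorphic_on ball 0 \<rho>" "\<And>z. norm z < \<rho> \<Longrightarrow> g z = exp (h z)"
    and h_le: "\<And>z. norm z \<le> 7 / 8 * \<rho> \<Longrightarrow> norm (h z - h 0) \<le> 14 * L"
    and Y0_le: "norm (Y 0) \<le> \<rho> ^ length zs * norm (g 0)" and "0 < L"
    by (rule zero_exp_factorization[OF Y \<rho> MY Y0 L]) blast+
  define n where "n = length zs"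
  have "norm (q z * g z) \<le> M / (2 * \<rho>) ^ n"
  proof (rule maximum_modulus_cball[of "\<lambda>z. q z * g z", of _ "3 * \<rho>"])
    show "(\<lambda>z. q z * g z) holomorphic_on ball 0 (4 * \<rho>)" using q g by (intro holomorphic_intros)
    fix w :: complex assume w: "norm w = 3 * \<rho>"
    have "(2 * \<rho>) ^ n \<le> prod_list (map (\<lambda>v. norm (w - v)) zs)"
      unfolding n_def
    proof (rule prod_list_ge_power)
      fix v assume "v \<in> set zs"
      then have "norm v \<le> \<rho>" by (auto simp: zs)
      then show "2 * \<rho> \<le> norm (w - v)" using w norm_triangle_ineq2[of w v] by linarith
    qed (use \<rho> in auto)
    then have "(2 * \<rho>) ^ n * norm (q w * g w) \<le> prod_list (map (\<lambda>v. norm (w - v)) zs) * norm (q w * g w)"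
      by (intro mult_right_mono) auto
    also have "\<dots> = norm (X w)"
      using fac[of w] eq[of w] w \<rho> by (simp add: norm_mult norm_prod_list)
    also have "\<dots> \<le> M" using MX w \<rho> by simp
    finally show "norm (q w * g w) \<le> M / (2 * \<rho>) ^ n" using \<rho> by (simp add: field_simps)
  qed (use \<rho> z in auto)
  moreover have "norm (g 0) * exp (- (14 * L)) \<le> norm (g z)"
  proof -
    have "Re (h 0) - Re (h z) \<le> 14 * L"
      using h_le[OF z] abs_Re_le_cmod[of "h z - h 0"] by simp
    then show ?thesis
      using h(2)[of 0] h(2)[of z] z \<rho> by (simp flip: exp_add)
  qed
  ultimately have "norm (q z) * (norm (g 0) * exp (- (14 * L))) \<le> M / (2 * \<rho>) ^ n"
    by (metis (no_types, lifting) mult_left_mono norm_ge_zero norm_mult order_trans)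
  then have "norm (q z) * (norm (g 0) * \<rho> ^ n) * exp (- (14 * L)) \<le> M / 2 ^ n"
    using \<rho> by (simp add: power_mult_distrib field_simps)
  also have "norm (q z) * norm (Y 0) * exp (- (14 * L))
      \<le> norm (q z) * (norm (g 0) * \<rho> ^ n) * exp (- (14 * L))"
    using Y0_le by (intro mult_right_mono mult_left_mono) (auto simp: n_def mult.commute)
  finally have *: "norm (q z) * norm (Y 0) * exp (- (14 * L)) \<le> M / 2 ^ n" by simp
  have Mpos: "0 < norm (Y 0)" "norm (Y 0) \<le> M" using MY[of 0] Y0 \<rho> by simp_all
  then have "M / 2 ^ n \<le> M" using order_trans[OF norm_ge_zero Mpos(2)] mult_left_mono[of 1 "2 ^ n" M] by (simp add: divide_le_eq)
  with * have "norm (q z) * norm (Y 0) * exp (- (14 * L)) \<le> M" by linarith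
  then have "norm (q z) * exp (- (14 * L)) \<le> M / norm (Y 0)"
    using Mpos by (simp add: field_simps)
  also have "\<dots> = exp (ln (M / norm (Y 0)))"
    using divide_pos_pos[OF less_le_trans[OF Mpos] Mpos(1)] by simp
  also have "\<dots> \<le> exp L" using L by simp
  finally have "norm (q z) \<le> exp L * exp (14 * L)" by (simp add: exp_minus field_simps)
  then show ?thesis by (simp flip: exp_add)
qed

lemma has_field_derivative_prod_list:
  fixes z :: complex
  assumes "z \<notin> set zs"
  shows "((\<lambda>z. prod_list (map (\<lambda>w. z - w) zs)) has_field_derivative
          prod_list (map (\<lambda>w. z - w) zs) * sum_list (map (\<lambda>w. 1 / (z - w)) zs)) (at z)"
  using assms
proof (induction zs)
  case (Cons a zs)
  then show ?case
    by (auto intro!: derivative_eq_intros simp: field_simps)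
qed simp

lemma norm_sum_list_le: "norm (sum_list (map f xs)) \<le> sum_list (map (\<lambda>x. norm (f x)) xs)"
  for f :: "'a \<Rightarrow> 'b::real_normed_vector"
  by (induction xs) (auto intro: norm_triangle_le)

text \<open>Each factor grows at most by 1 + |\<eta>| / |z - w| \<le> exp (|\<eta>| / |z - w|). The
  exponent contains the same sum of reciprocal distances as the bound for the logarithmic
  derivative, so one choice of radius serves both.\<close>

lemma norm_prod_list_shift_le:
  fixes z \<eta> :: complex
  assumes "z \<notin> set zs"
  shows "norm (prod_list (map (\<lambda>w. z + \<eta> - w) zs))
    \<le> norm (prod_list (map (\<lambda>w. z - w) zs)) * exp (norm \<eta> * sum_list (map (\<lambda>w. 1 / norm (z - w)) zs))"
  using assms
proof (induction zs)
  case (Cons a zs)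
  have za: "0 < norm (z - a)" using Cons.prems by auto
  have "norm (z + \<eta> - a) \<le> norm (z - a) + norm \<eta>"
    by (metis add_diff_eq add.commute norm_triangle_ineq)
  also have "\<dots> = norm (z - a) * (1 + norm \<eta> / norm (z - a))" using za by (simp add: field_simps)
  also have "\<dots> \<le> norm (z - a) * exp (norm \<eta> / norm (z - a))"
    by (intro mult_left_mono exp_ge_add_one_self) auto
  finally have "norm (prod_list (map (\<lambda>w. z + \<eta> - w) (a # zs)))
    \<le> (norm (z - a) * exp (norm \<eta> / norm (z - a))) *
      (norm (prod_list (map (\<lambda>w. z - w) zs)) * exp (norm \<eta> * sum_list (map (\<lambda>w. 1 / norm (z - w)) zs)))"
    using Cons by (simp only: list.map prod_list.Cons norm_mult) (intro mult_mono, auto)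
  then show ?case by (simp add: norm_mult exp_add distrib_left mult_ac)
qed simp

text \<open>Write f = P exp h with \<open>P\<close> the product over the zeros. The zeros contribute
  the sum of reciprocal distances, and h' contributes 120 L / \<rho>: as a term of f' / f in the
  first bound, and through the mean value inequality for \<open>h\<close> in the second.\<close>

lemma log_deriv_and_shift_bounds:
  fixes f :: "complex \<Rightarrow> complex"
  assumes f: "f holomorphic_on ball 0 (4 * \<rho>)" and \<rho>: "0 < \<rho>"
    and M: "\<And>z. norm z < 4 * \<rho> \<Longrightarrow> norm (f z) \<le> M" and f0: "f 0 \<noteq> 0" and L: "ln (M / norm (f 0)) < L"
  obtains zs where "set zs = {z \<in> cball 0 \<rho>. f z = 0}" "real (length zs) \<le> 2 * L"
    "\<And>z. norm z \<le> 3 / 4 * \<rho> \<Longrightarrow> z \<notin> set zs \<Longrightarrow>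
       norm (deriv f z) \<le> norm (f z) * (sum_list (map (\<lambda>w. 1 / norm (z - w)) zs) + 120 * L / \<rho>)"
    "\<And>z \<eta>. norm z \<le> 3 / 4 * \<rho> \<Longrightarrow> z \<notin> set zs \<Longrightarrow> norm (z + \<eta>) \<le> 3 / 4 * \<rho> \<Longrightarrow>
       norm (f (z + \<eta>)) \<le> norm (f z) * exp (norm \<eta> * (sum_list (map (\<lambda>w. 1 / norm (z - w)) zs) + 120 * L / \<rho>))"
proof -
  obtain zs g h where zs: "set zs = {z \<in> cball 0 \<rho>. f z = 0}" and g: "g holomorphic_on ball 0 (4 * \<rho>)"
    and fac: "\<And>z. norm z < 4 * \<rho> \<Longrightarrow> f z = prod_list (map (\<lambda>w. z - w) zs) * g z"
    and len: "real (length zs) \<le> 2 * L" and h: "h holomorphic_on ball 0 \<rho>"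
    and gh: "\<And>z. norm z < \<rho> \<Longrightarrow> g z = exp (h z)"
    and h_le: "\<And>z. norm z \<le> 7 / 8 * \<rho> \<Longrightarrow> norm (h z - h 0) \<le> 14 * L"
    and f0_le: "norm (f 0) \<le> \<rho> ^ length zs * norm (g 0)" and Lpos: "0 < L"
    by (rule zero_exp_factorization[OF f \<rho> M f0 L]) blast+
  define P where "P = (\<lambda>z::complex. prod_list (map (\<lambda>w. z - w) zs))"
  define \<Sigma> where "\<Sigma> = (\<lambda>z::complex. sum_list (map (\<lambda>w. 1 / norm (z - w)) zs))"
  have fP: "f z = P z * exp (h z)" if "norm z < \<rho>" for z
    using fac[of z] gh[of z] that \<rho> by (simp add: P_def)
  have h': "(h has_field_derivative deriv h z) (at z)" if "norm z < \<rho>" for z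
    using holomorphic_derivI[OF h open_ball] that by simp
  have h'_le: "norm (deriv h z) \<le> 120 * L / \<rho>" if z: "norm z \<le> 3 / 4 * \<rho>" for z
  proof -
    have sub: "norm w \<le> 7 / 8 * \<rho>" if "w \<in> cball z (\<rho> / 8)" for w
      using z that norm_triangle_ineq2[of w z] by (simp add: dist_norm norm_minus_commute)
    have hz: "h holomorphic_on cball z (\<rho> / 8)"
      by (rule holomorphic_on_subset[OF h]) (use sub \<rho> in fastforce)
    \<comment> \<open>Discs of radius \<rho> / 8 about points with |z| \<le> 3/4 \<rho> stay where
      \<open>h\<close> is controlled. The bound 14 L becomes 15 L because the Cauchy estimate asks
      for values in an open ball.\<close>
    have "norm ((deriv ^^ 1) h z) \<le> fact 1 * (15 * L) / (\<rho> / 8) ^ 1"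
    proof (rule Cauchy_higher_deriv_bound[where y = "h 0"])
      show "h holomorphic_on ball z (\<rho> / 8)"
        using hz by (rule holomorphic_on_subset) auto
      show "continuous_on (cball z (\<rho> / 8)) h"
        using hz by (rule holomorphic_on_imp_continuous_on)
      fix w assume "w \<in> ball z (\<rho> / 8)"
      then have "norm (h w - h 0) \<le> 14 * L" using h_le sub by auto
      then show "h w \<in> ball (h 0) (15 * L)" using Lpos by (simp add: dist_norm norm_minus_commute)
    qed (use \<rho> in auto)
    then show ?thesis by simp
  qed
  have h_diff: "norm (h (z + \<eta>) - h z) \<le> 120 * L / \<rho> * norm \<eta>"
    if "norm z \<le> 3 / 4 * \<rho>" "norm (z + \<eta>) \<le> 3 / 4 * \<rho>" for z \<eta>
  proof -
    have "norm (h (z + \<eta>) - h z) \<le> 120 * L / \<rho> * norm ((z + \<eta>) - z)"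
    proof (rule field_differentiable_bound[of "cball 0 (3 / 4 * \<rho>)" h "deriv h"])
      fix w :: complex assume "w \<in> cball 0 (3 / 4 * \<rho>)"
      then show "(h has_field_derivative deriv h w) (at w within cball 0 (3 / 4 * \<rho>))"
        using h'[of w] \<rho> by (auto intro: has_field_derivative_at_within)
    qed (use that h'_le in auto)
    then show ?thesis by simp
  qed
  show ?thesis
  proof (rule that[OF zs len])
    fix z assume z: "norm z \<le> 3 / 4 * \<rho>" "z \<notin> set zs"
    have "((\<lambda>z. P z * exp (h z)) has_field_derivative
        P z * sum_list (map (\<lambda>w. 1 / (z - w)) zs) * exp (h z) + exp (h z) * deriv h z * P z) (at z)"
      unfolding P_def by (rule DERIV_mult has_field_derivative_prod_list z DERIV_fun_exp h')+ (use z \<rho> in auto)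
    then have "(f has_field_derivative
        P z * sum_list (map (\<lambda>w. 1 / (z - w)) zs) * exp (h z) + exp (h z) * deriv h z * P z) (at z)"
      by (rule has_field_derivative_transform_within_open[where S = "ball 0 \<rho>"]) (use z \<rho> fP in auto)
    then have "deriv f z = f z * (sum_list (map (\<lambda>w. 1 / (z - w)) zs) + deriv h z)"
      using fP[of z] z \<rho> by (simp add: DERIV_imp_deriv algebra_simps)
    moreover have "norm (sum_list (map (\<lambda>w. 1 / (z - w)) zs)) \<le> \<Sigma> z"
      using norm_sum_list_le[of "\<lambda>w. 1 / (z - w)" zs] by (simp add: \<Sigma>_def norm_divide)
    ultimately show "norm (deriv f z) \<le> norm (f z) * (sum_list (map (\<lambda>w. 1 / norm (z - w)) zs) + 120 * L / \<rho>)"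
      unfolding \<Sigma>_def[symmetric] using h'_le[OF z(1)]
      by (simp add: norm_mult) (intro mult_left_mono norm_triangle_le add_mono, auto simp: \<Sigma>_def)
    fix \<eta> :: complex assume z': "norm (z + \<eta>) \<le> 3 / 4 * \<rho>"
    have "norm (f (z + \<eta>)) = norm (P (z + \<eta>)) * exp (Re (h (z + \<eta>)))"
      using fP[of "z + \<eta>"] z' \<rho> by (simp add: norm_mult)
    also have "\<dots> \<le> (norm (P z) * exp (norm \<eta> * \<Sigma> z)) * exp (Re (h z) + norm \<eta> * (120 * L / \<rho>))"
    proof (intro mult_mono)
      show "norm (P (z + \<eta>)) \<le> norm (P z) * exp (norm \<eta> * \<Sigma> z)"
        unfolding P_def \<Sigma>_def using z(2) by (rule norm_prod_list_shift_le)
      have "Re (h (z + \<eta>) - h z) \<le> norm \<eta> * (120 * L / \<rho>)"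
        using h_diff[OF z(1) z'] complex_Re_le_cmod[of "h (z + \<eta>) - h z"] by (simp add: mult.commute)
      then show "exp (Re (h (z + \<eta>))) \<le> exp (Re (h z) + norm \<eta> * (120 * L / \<rho>))" by simp
    qed auto
    also have "\<dots> = norm (f z) * exp (norm \<eta> * (\<Sigma> z + 120 * L / \<rho>))"
      using fP[of z] z \<rho> by (simp add: norm_mult exp_add algebra_simps)
    finally show "norm (f (z + \<eta>)) \<le> norm (f z) * exp (norm \<eta> * (sum_list (map (\<lambda>w. 1 / norm (z - w)) zs) + 120 * L / \<rho>))"
      by (simp add: \<Sigma>_def)
  qed
qed

section \<open>Harmonic sums and radii away from given points\<close>

text \<open>The k-th smallest element of a set of positive integers is at least k. The induction
  removes the maximum, which is at least \<open>card S\<close>.\<close>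

lemma sum_inverse_le_harm:
  assumes "finite S" "0 \<notin> S"
  shows "(\<Sum>k\<in>S. 1 / real k) \<le> harm (card S)"
  using assms
proof (induction "card S" arbitrary: S)
  case (Suc n)
  then have ne: "S \<noteq> {}" by auto
  define m where "m = Max S"
  have m: "m \<in> S" using Suc ne by (simp add: m_def)
  have "S \<subseteq> {1..m}"
  proof
    fix x assume "x \<in> S"
    then show "x \<in> {1..m}"
      using Suc.prems Max_ge[of S x] by (cases x) (auto simp: m_def)
  qed
  then have "Suc n \<le> m" using card_mono[of "{1..m}" S] Suc.hyps(2) by simp
  have "n = card (S - {m})" using Suc.hyps(2) Suc.prems m by simp
  then have "(\<Sum>k\<in>S - {m}. 1 / real k) \<le> harm n"
    using Suc.hyps(1)[of "S - {m}"] Suc.prems by simp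
  moreover have "(\<Sum>k\<in>S. 1 / real k) = 1 / real m + (\<Sum>k\<in>S - {m}. 1 / real k)"
    using Suc.prems m by (simp add: sum.remove)
  moreover have "1 / real m \<le> 1 / real (Suc n)"
    using \<open>Suc n \<le> m\<close> by (intro divide_left_mono) auto
  ultimately show ?case
    unfolding Suc.hyps(2)[symmetric] by (simp add: harm_Suc inverse_eq_divide)
qed (auto simp: harm_def)

text \<open>The difference of the harmonic number and the logarithm decreases from its value 1 at n
  = 1.\<close>

lemma harm_le_ln: "0 < n \<Longrightarrow> harm n \<le> 1 + ln (real n)"
proof (cases n)
  case (Suc m)
  have "harm (Suc m) - ln (real (Suc m)) \<le> harm (Suc 0) - ln (real (Suc 0))"
    using decseq_harm_diff_ln by (rule decseqD) simp
  then show ?thesis using Suc by (simp add: harm_expand)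
qed simp

text \<open>On either side of \<open>i\<close> the distances are distinct positive integers, so each
  side contributes at most one harmonic number.\<close>

lemma sum_inverse_dist_le:
  fixes i :: int
  assumes S: "finite S" "i \<notin> S"
  shows "(\<Sum>j\<in>S. 1 / \<bar>real_of_int j - real_of_int i\<bar>) \<le> 2 * harm (card S)"
proof -
  have *: "(\<Sum>j\<in>T. 1 / \<bar>real_of_int j - real_of_int i\<bar>) \<le> harm (card S)"
    if T: "T \<subseteq> S" "inj_on (\<lambda>j. nat \<bar>j - i\<bar>) T" for T
  proof -
    have fT: "finite T" using T(1) S(1) by (rule finite_subset)
    have "(\<Sum>j\<in>T. 1 / \<bar>real_of_int j - real_of_int i\<bar>) = (\<Sum>k\<in>(\<lambda>j. nat \<bar>j - i\<bar>) ` T. 1 / real k)"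
      by (subst sum.reindex[OF T(2)]) (auto intro!: sum.cong)
    also have "\<dots> \<le> harm (card ((\<lambda>j. nat \<bar>j - i\<bar>) ` T))"
      by (rule sum_inverse_le_harm) (use fT S T in auto)
    also have "\<dots> \<le> harm (card S)"
      by (intro harm_mono order_trans[OF card_image_le[OF fT]] card_mono S T)
    finally show ?thesis .
  qed
  have "S = {j\<in>S. i < j} \<union> {j\<in>S. j < i}" using S(2) by (auto simp: not_less order_le_less)
  then have "(\<Sum>j\<in>S. 1 / \<bar>real_of_int j - real_of_int i\<bar>)
    = (\<Sum>j\<in>{j\<in>S. i < j} \<union> {j\<in>S. j < i}. 1 / \<bar>real_of_int j - real_of_int i\<bar>)"
    by simp
  also have "\<dots> = (\<Sum>j\<in>{j\<in>S. i < j}. 1 / \<bar>real_of_int j - real_of_int i\<bar>)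
      + (\<Sum>j\<in>{j\<in>S. j < i}. 1 / \<bar>real_of_int j - real_of_int i\<bar>)"
    by (rule sum.union_disjoint) (use S in auto)
  also have "\<dots> \<le> harm (card S) + harm (card S)"
    by (intro add_mono *) (auto simp: inj_on_def)
  finally show ?thesis by simp
qed

text \<open>Averaging over \<open>2n\<close> equidistant radii, after discarding for each of the \<open>n\<close> points the
  nearest one.\<close>
lemma exists_radius_sum_inverse_dist_le:
  fixes ts :: "real list"
  assumes R: "0 < R" and n: "length ts \<le> n" "0 < n"
  obtains r where "R \<le> r" "r \<le> 2 * R" "r \<notin> set ts"
    "sum_list (map (\<lambda>t. 1 / \<bar>r - t\<bar>) ts) \<le> 8 * real n * (1 + ln (2 * real n)) / R"
proof -
  define N where "N = 2 * n"
  define \<tau> where "\<tau> = (\<lambda>t. (t - R) * real N / R)"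
  define rad where "rad = (\<lambda>j::int. R + of_int j * R / real N)"
  define J where "J = {0..<int N} - (\<lambda>t. round (\<tau> t)) ` set ts"
  have N: "0 < N" using n by (simp add: N_def)
  have finJ: "finite J" by (simp add: J_def)
  have "card ((\<lambda>t. round (\<tau> t)) ` set ts) \<le> n"
    by (rule order_trans[OF card_image_le order_trans[OF card_length n(1)]]) simp
  then have cardJ: "n \<le> card J"
    using diff_card_le_card_Diff[of "(\<lambda>t. round (\<tau> t)) ` set ts" "{0..<int N}"] by (simp add: J_def N_def)
  have cardJN: "card J \<le> N" using card_mono[of "{0..<int N}" J] by (simp add: J_def)
  have dist: "rad j - t = (of_int j - \<tau> t) * (R / real N)" for j t
    using R N by (simp add: rad_def \<tau>_def field_simps)
  \<comment> \<open>As \<open>j\<close> is not the integer nearest to \<open>\<tau> t\<close>,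
    replacing \<open>\<tau> t\<close> by that integer at most doubles its distance from
    \<open>j\<close>. This reduces the sums over radii to sums over integers.\<close>
  have far: "1 / 2 * \<bar>of_int j - of_int (round (\<tau> t))\<bar> \<le> \<bar>of_int j - \<tau> t\<bar>" "j \<noteq> round (\<tau> t)"
    if "j \<in> J" "t \<in> set ts" for j t
  proof -
    show ne: "j \<noteq> round (\<tau> t)" using that by (auto simp: J_def)
    then have "1 \<le> \<bar>real_of_int j - of_int (round (\<tau> t))\<bar>"
      by (metis abs_ge_zero int_one_le_iff_zero_less of_int_1_le_iff of_int_abs of_int_diff
          right_minus_eq zero_less_abs_iff)
    moreover have "\<bar>of_int (round (\<tau> t)) - \<tau> t\<bar> \<le> 1 / 2" by (rule of_int_round_abs_le)
    moreover have "\<bar>real_of_int j - of_int (round (\<tau> t))\<bar>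
        \<le> \<bar>of_int j - \<tau> t\<bar> + \<bar>of_int (round (\<tau> t)) - \<tau> t\<bar>"
      by (simp add: abs_if)
    moreover have "1 / 2 * x \<le> y" if "1 \<le> x" "u \<le> 1 / 2" "x \<le> y + u" for x y u :: real
      using that by simp
    ultimately show "1 / 2 * \<bar>of_int j - of_int (round (\<tau> t))\<bar> \<le> \<bar>of_int j - \<tau> t\<bar>" by blast
  qed
  have single: "(\<Sum>j\<in>J. 1 / \<bar>rad j - t\<bar>) \<le> 4 * harm N * (real N / R)" if t: "t \<in> set ts" for t
  proof -
    have "(\<Sum>j\<in>J. 1 / \<bar>rad j - t\<bar>) \<le> (\<Sum>j\<in>J. (2 * real N / R) * (1 / \<bar>of_int j - of_int (round (\<tau> t))\<bar>))"
    proof (rule sum_mono)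
      fix j assume j: "j \<in> J"
      have pos: "0 < \<bar>real_of_int j - of_int (round (\<tau> t))\<bar>" using far(2)[OF j t] by simp
      have "1 / \<bar>rad j - t\<bar> \<le> 1 / ((1 / 2 * \<bar>of_int j - of_int (round (\<tau> t))\<bar>) * (R / real N))"
        unfolding dist abs_mult using far(1)[OF j t] pos R N
        by (intro divide_left_mono mult_mono mult_pos_pos) (auto simp del: abs_divide)
      then show "1 / \<bar>rad j - t\<bar> \<le> (2 * real N / R) * (1 / \<bar>of_int j - of_int (round (\<tau> t))\<bar>)"
        using R N by (simp add: field_simps)
    qed
    also have "\<dots> = (2 * real N / R) * (\<Sum>j\<in>J. 1 / \<bar>of_int j - of_int (round (\<tau> t))\<bar>)"
      by (simp only: sum_distrib_left)
    also have "\<dots> \<le> (2 * real N / R) * (2 * harm (card J))"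
      using sum_inverse_dist_le[OF finJ, of "round (\<tau> t)"] far(2) t R
      by (intro mult_left_mono) auto
    also have "\<dots> \<le> (2 * real N / R) * (2 * harm N)"
      using R by (intro mult_left_mono harm_mono cardJN) auto
    finally show ?thesis by (simp add: mult_ac)
  qed
  have "(\<Sum>j\<in>J. sum_list (map (\<lambda>t. 1 / \<bar>rad j - t\<bar>) us)) \<le> real (length us) * (4 * harm N * (real N / R))"
    if "set us \<subseteq> set ts" for us
    using that
  proof (induction us)
    case (Cons t us)
    then show ?case using single[of t] by (simp add: sum.distrib distrib_right add_divide_distrib)
  qed simp
  then have total: "(\<Sum>j\<in>J. sum_list (map (\<lambda>t. 1 / \<bar>rad j - t\<bar>) ts)) \<le> real (length ts) * (4 * harm N * (real N / R))"
    by simp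
  \<comment> \<open>At least n radii survive and there are at most n points, so the average over
    \<open>J\<close> is no larger than the bound for a single point.\<close>
  have "\<exists>j\<in>J. sum_list (map (\<lambda>t. 1 / \<bar>rad j - t\<bar>) ts) \<le> 4 * harm N * (real N / R)"
  proof (rule ccontr)
    assume "\<not> ?thesis"
    then have "(\<Sum>j\<in>J. 4 * harm N * (real N / R)) < (\<Sum>j\<in>J. sum_list (map (\<lambda>t. 1 / \<bar>rad j - t\<bar>) ts))"
      using cardJ n by (intro sum_strict_mono finJ) auto
    moreover have "real (length ts) * (4 * harm N * (real N / R)) \<le> real (card J) * (4 * harm N * (real N / R))"
      using n(1) cardJ R harm_nonneg[of N, where ?'a = real] by (intro mult_right_mono) auto
    ultimately show False using total by simp
  qed
  then obtain j where j: "j \<in> J" "sum_list (map (\<lambda>t. 1 / \<bar>rad j - t\<bar>) ts) \<le> 4 * harm N * (real N / R)"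
    by blast
  show ?thesis
  proof (rule that)
    have "0 \<le> j" "real_of_int j \<le> real N" using j(1) by (auto simp: J_def)
    then show "R \<le> rad j" "rad j \<le> 2 * R"
      using R N by (auto simp: rad_def divide_le_eq mult_left_mono)
    show "rad j \<notin> set ts"
    proof
      assume t: "rad j \<in> set ts"
      then have "of_int j = \<tau> (rad j)" using dist[of j "rad j"] R N by simp
      then show False using far(2)[OF j(1) t] by (metis round_of_int)
    qed
    have "harm N \<le> 1 + ln (2 * real n)" using harm_le_ln[OF N] by (simp add: N_def)
    then have "4 * harm N * (real N / R) \<le> 4 * (1 + ln (2 * real n)) * (real N / R)"
      using R by (intro mult_right_mono) auto
    then show "sum_list (map (\<lambda>t. 1 / \<bar>rad j - t\<bar>) ts) \<le> 8 * real n * (1 + ln (2 * real n)) / R"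
      using j(2) by (simp add: N_def mult_ac)
  qed
qed

subsection \<open>Functions of finite order on good circles\<close>

text \<open>The base 1 + |z| is at least 1. So the bound holds without exception near 0, and a
  larger exponent gives a weaker condition.\<close>

definition growth_le :: "real \<Rightarrow> (complex \<Rightarrow> complex) \<Rightarrow> bool" where
  "growth_le s f \<longleftrightarrow> (\<exists>C. \<forall>z. norm (f z) \<le> exp (C * (1 + norm z) powr s))"

lemma growth_leE:
  assumes "growth_le s f"
  obtains C where "0 < C" "\<And>z. norm (f z) \<le> exp (C * (1 + norm z) powr s)"
proof -
  obtain C where C: "\<And>z. norm (f z) \<le> exp (C * (1 + norm z) powr s)"
    using assms by (auto simp: growth_le_def)
  show ?thesis
  proof (rule that[of "\<bar>C\<bar> + 1"])
    fix z :: complex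
    have "C * (1 + norm z) powr s \<le> (\<bar>C\<bar> + 1) * (1 + norm z) powr s"
      by (intro mult_right_mono) auto
    then show "norm (f z) \<le> exp ((\<bar>C\<bar> + 1) * (1 + norm z) powr s)"
      using C[of z] by (meson exp_le_cancel_iff order_trans)
  qed simp
qed

lemma growth_le_const: "0 \<le> s \<Longrightarrow> growth_le s (\<lambda>_. c)"
proof -
  assume s: "0 \<le> s"
  have "norm c \<le> exp (norm c * (1 + norm z) powr s)" for z :: complex
  proof -
    have "norm c * 1 \<le> norm c * (1 + norm z) powr s"
      using s by (intro mult_left_mono ge_one_powr_ge_zero) auto
    then show ?thesis
      using exp_ge_add_one_self[of "norm c * (1 + norm z) powr s"] by linarith
  qed
  then show ?thesis unfolding growth_le_def by blast
qed

lemma growth_le_add: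
  assumes s: "0 \<le> s" and "growth_le s f" "growth_le s g"
  shows "growth_le s (\<lambda>z. f z + g z)"
proof -
  obtain C where C: "0 < C" "\<And>z. norm (f z) \<le> exp (C * (1 + norm z) powr s)"
    using growth_leE[OF assms(2)] by blast
  obtain D where D: "0 < D" "\<And>z. norm (g z) \<le> exp (D * (1 + norm z) powr s)"
    using growth_leE[OF assms(3)] by blast
  have "norm (f z + g z) \<le> exp ((C + D + 1) * (1 + norm z) powr s)" for z
  proof -
    define x where "x = (1 + norm z) powr s"
    have x: "1 \<le> x" using s by (auto simp: x_def intro: ge_one_powr_ge_zero)
    have "norm (f z + g z) \<le> exp (C * x) + exp (D * x)"
      using C(2)[of z] D(2)[of z] by (intro norm_triangle_le add_mono) (auto simp: x_def)
    also have "\<dots> \<le> exp ((C + D) * x) + exp ((C + D) * x)"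
      using C(1) D(1) x by (intro add_mono) (auto intro!: mult_right_mono)
    also have "\<dots> \<le> exp ((C + D) * x) * exp x"
      using mult_left_mono[of 2 "exp x" "exp ((C + D) * x)"] order_trans[OF _ exp_ge_add_one_self, of 2 x] x by simp
    also have "\<dots> = exp ((C + D + 1) * x)" by (simp add: exp_add[symmetric] algebra_simps)
    finally show ?thesis by (simp add: x_def)
  qed
  then show ?thesis unfolding growth_le_def by blast
qed

lemma growth_le_uminus: "growth_le s f \<Longrightarrow> growth_le s (\<lambda>z. - f z)"
  by (simp add: growth_le_def)

lemma growth_le_diff:
  "0 \<le> s \<Longrightarrow> growth_le s f \<Longrightarrow> growth_le s g \<Longrightarrow> growth_le s (\<lambda>z. f z - g z)"
  using growth_le_add[OF _ _ growth_le_uminus, of s f g] by simp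

lemma growth_le_shift:
  assumes s: "0 \<le> s" and "growth_le s f"
  shows "growth_le s (\<lambda>z. f (z + p))"
proof -
  obtain C where C: "0 < C" "\<And>z. norm (f z) \<le> exp (C * (1 + norm z) powr s)"
    using growth_leE[OF assms(2)] by blast
  have "norm (f (z + p)) \<le> exp ((C * (1 + norm p) powr s) * (1 + norm z) powr s)" for z
  proof -
    have "1 + norm (z + p) \<le> (1 + norm p) * (1 + norm z)"
      using norm_triangle_ineq[of z p] mult_nonneg_nonneg[OF norm_ge_zero norm_ge_zero, of p z]
      by (simp only: distrib_left distrib_right)
    then have "(1 + norm (z + p)) powr s \<le> ((1 + norm p) * (1 + norm z)) powr s"
      using s by (intro powr_mono2) auto
    also have "\<dots> = (1 + norm p) powr s * (1 + norm z) powr s" by (rule powr_mult)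
    finally have "C * (1 + norm (z + p)) powr s \<le> C * ((1 + norm p) powr s * (1 + norm z) powr s)"
      using C(1) by simp
    then show ?thesis
      using C(2)[of "z + p"] by (simp add: mult.assoc) (meson exp_le_cancel_iff order_trans)
  qed
  then show ?thesis unfolding growth_le_def by blast
qed

lemma growth_le_mono:
  assumes "s \<le> t" "growth_le s f"
  shows "growth_le t f"
proof -
  obtain C where C: "0 < C" "\<And>z. norm (f z) \<le> exp (C * (1 + norm z) powr s)"
    using growth_leE[OF assms(2)] by blast
  have "norm (f z) \<le> exp (C * (1 + norm z) powr t)" for z
  proof -
    have "(1 + norm z) powr s \<le> (1 + norm z) powr t" using assms(1) by (intro powr_mono) auto
    then have "exp (C * (1 + norm z) powr s) \<le> exp (C * (1 + norm z) powr t)" using C(1) by simp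
    then show ?thesis using C(2)[of z] by linarith
  qed
  then show ?thesis unfolding growth_le_def by blast
qed

section \<open>Logarithmic derivatives and shift quotients outside a list of exceptional
  points\<close>

text \<open>Several functions are to share one list of exceptional points. Hence \<open>zs\<close>
  need only contain the zeros, and the property survives concatenating further points.\<close>

definition log_deriv_controlled :: "complex list \<Rightarrow> real \<Rightarrow> real \<Rightarrow> (complex \<Rightarrow> complex) \<Rightarrow> bool" where
  "log_deriv_controlled zs R \<epsilon> f \<longleftrightarrow> {z \<in> cball 0 (4 * R). f z = 0} \<subseteq> set zs \<and>
     (\<forall>z. norm z \<le> 3 * R \<longrightarrow> z \<notin> set zs \<longrightarrow>
       norm (deriv f z) \<le> norm (f z) * (sum_list (map (\<lambda>w. 1 / norm (z - w)) zs) + \<epsilon>) \<and>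
       (\<forall>\<eta>. norm (z + \<eta>) \<le> 3 * R \<longrightarrow>
          norm (f (z + \<eta>)) \<le> norm (f z) * exp (norm \<eta> * (sum_list (map (\<lambda>w. 1 / norm (z - w)) zs) + \<epsilon>))))"

lemma log_deriv_controlled_mono:
  assumes "log_deriv_controlled zs R \<epsilon> f" "\<epsilon> \<le> \<epsilon>'"
    "set zs \<subseteq> set zs'" "\<And>z. sum_list (map (\<lambda>w. 1 / norm (z - w)) zs) \<le> sum_list (map (\<lambda>w. 1 / norm (z - w)) zs')"
  shows "log_deriv_controlled zs' R \<epsilon>' f"
proof -
  have le: "sum_list (map (\<lambda>w. 1 / norm (z - w)) zs) + \<epsilon> \<le> sum_list (map (\<lambda>w. 1 / norm (z - w)) zs') + \<epsilon>'" for z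
    using assms(2) assms(4)[of z] by linarith
  show ?thesis
    unfolding log_deriv_controlled_def
  proof (intro conjI allI impI)
    show "{z \<in> cball 0 (4 * R). f z = 0} \<subseteq> set zs'"
      using assms(1,3) unfolding log_deriv_controlled_def by blast
    fix z assume z: "norm z \<le> 3 * R" "z \<notin> set zs'"
    then have z': "z \<notin> set zs" using assms(3) by auto
    have "norm (deriv f z) \<le> norm (f z) * (sum_list (map (\<lambda>w. 1 / norm (z - w)) zs) + \<epsilon>)"
      using assms(1) z(1) z' unfolding log_deriv_controlled_def by blast
    also have "\<dots> \<le> norm (f z) * (sum_list (map (\<lambda>w. 1 / norm (z - w)) zs') + \<epsilon>')"
      by (intro mult_left_mono le) auto
    finally show "norm (deriv f z) \<le> norm (f z) * (sum_list (map (\<lambda>w. 1 / norm (z - w)) zs') + \<epsilon>')" .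
    fix \<eta> assume "norm (z + \<eta>) \<le> 3 * R"
    then have "norm (f (z + \<eta>)) \<le> norm (f z) * exp (norm \<eta> * (sum_list (map (\<lambda>w. 1 / norm (z - w)) zs) + \<epsilon>))"
      using assms(1) z(1) z' unfolding log_deriv_controlled_def by blast
    also have "\<dots> \<le> norm (f z) * exp (norm \<eta> * (sum_list (map (\<lambda>w. 1 / norm (z - w)) zs') + \<epsilon>'))"
      by (intro mult_left_mono iffD2[OF exp_le_cancel_iff] le) auto
    finally show "norm (f (z + \<eta>)) \<le> norm (f z) * exp (norm \<eta> * (sum_list (map (\<lambda>w. 1 / norm (z - w)) zs') + \<epsilon>'))" .
  qed
qed

text \<open>The factorization is used with \<rho> = 4 R and L of order R^s. The error term of order
  L / \<rho> is then of order R^(s - 1), which is the gain of one power.\<close>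

lemma growth_le_log_deriv_controlled_single:
  assumes f: "f holomorphic_on UNIV" and gr: "growth_le s f" and f0: "f 0 \<noteq> 0" and s: "0 \<le> s"
  shows "\<exists>K\<ge>0. \<forall>R\<ge>1. \<exists>zs. set zs = {z \<in> cball 0 (4 * R). f z = 0} \<and>
    real (length zs) \<le> K * R powr s \<and> log_deriv_controlled zs R (K * R powr (s - 1)) f"
proof -
  obtain C where C: "0 < C" "\<And>z. norm (f z) \<le> exp (C * (1 + norm z) powr s)"
    using growth_leE[OF gr] by blast
  define K0 where "K0 = C * 17 powr s + \<bar>ln (norm (f 0))\<bar> + 1"
  have K0: "0 < K0" using C(1) by (simp add: K0_def add_nonneg_pos)
  show ?thesis
  proof (intro exI[of _ "30 * K0"] conjI allI impI)
    fix R :: real assume R: "1 \<le> R"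
    \<comment> \<open>The factorization needs a bound for |z| < 4 \<rho> = 16 R, where 1 + |z| \<le>
      17 R.\<close>
    define M where "M = exp (C * (17 * R) powr s)"
    define L where "L = K0 * R powr s"
    have R1: "1 \<le> R powr s" using R s by (rule ge_one_powr_ge_zero)
    have M: "norm (f z) \<le> M" if "norm z < 4 * (4 * R)" for z
    proof -
      have "(1 + norm z) powr s \<le> (17 * R) powr s"
        using that R s by (intro powr_mono2) auto
      then have "exp (C * (1 + norm z) powr s) \<le> M" using C(1) by (simp add: M_def)
      then show ?thesis using C(2)[of z] by linarith
    qed
    have "ln (M / norm (f 0)) = C * (17 powr s * R powr s) - ln (norm (f 0))"
      using f0 R by (simp add: M_def ln_div powr_mult)
    also have "\<dots> < C * 17 powr s * R powr s + (\<bar>ln (norm (f 0))\<bar> + 1) * 1" by (simp add: mult.assoc)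
    also have "\<dots> \<le> C * 17 powr s * R powr s + (\<bar>ln (norm (f 0))\<bar> + 1) * R powr s"
      by (intro add_left_mono mult_left_mono R1) auto
    also have "\<dots> = L" by (simp add: L_def K0_def algebra_simps)
    finally have ln_less: "ln (M / norm (f 0)) < L" .
    have fR: "f holomorphic_on ball 0 (4 * (4 * R))" by (rule holomorphic_on_subset[OF f]) simp
    obtain zs where zs: "set zs = {z \<in> cball 0 (4 * R). f z = 0}" "real (length zs) \<le> 2 * L"
      "\<And>z. norm z \<le> 3 / 4 * (4 * R) \<Longrightarrow> z \<notin> set zs \<Longrightarrow>
        norm (deriv f z) \<le> norm (f z) * (sum_list (map (\<lambda>w. 1 / norm (z - w)) zs) + 120 * L / (4 * R))"
      "\<And>z \<eta>. norm z \<le> 3 / 4 * (4 * R) \<Longrightarrow> z \<notin> set zs \<Longrightarrow> norm (z + \<eta>) \<le> 3 / 4 * (4 * R) \<Longrightarrow>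
        norm (f (z + \<eta>)) \<le> norm (f z) * exp (norm \<eta> * (sum_list (map (\<lambda>w. 1 / norm (z - w)) zs) + 120 * L / (4 * R)))"
      by (rule log_deriv_and_shift_bounds[OF fR _ M f0 ln_less]) (use R in simp, blast+)
    have *: "120 * L / (4 * R) = 30 * K0 * R powr (s - 1)"
      using R by (simp add: L_def powr_diff)
    show "\<exists>zs. set zs = {z \<in> cball 0 (4 * R). f z = 0} \<and>
      real (length zs) \<le> 30 * K0 * R powr s \<and> log_deriv_controlled zs R (30 * K0 * R powr (s - 1)) f"
    proof (intro exI[of _ zs] conjI)
      have "2 * L \<le> 30 * L" using K0 by (simp add: L_def)
      then show "real (length zs) \<le> 30 * K0 * R powr s" using zs(2) by (simp add: L_def)
      show "log_deriv_controlled zs R (30 * K0 * R powr (s - 1)) f"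
        unfolding log_deriv_controlled_def using zs(3,4) unfolding * by (simp add: zs(1))
    qed (rule zs(1))
  qed (use K0 in simp)
qed

lemma growth_le_log_deriv_controlled:
  assumes "\<And>f. f \<in> set fs \<Longrightarrow> f holomorphic_on UNIV \<and> growth_le s f \<and> f 0 \<noteq> 0" and s: "0 \<le> s"
  shows "\<exists>K\<ge>0. \<forall>R\<ge>1. \<exists>zs. real (length zs) \<le> K * R powr s \<and>
    (\<forall>f\<in>set fs. log_deriv_controlled zs R (K * R powr (s - 1)) f)"
  using assms(1)
proof (induction fs)
  case Nil
  show ?case by (intro exI[of _ 0]) (auto intro: exI[of _ "[]"])
next
  case (Cons f fs)
  obtain K1 where K1: "0 \<le> K1" "\<And>R. 1 \<le> R \<Longrightarrow> \<exists>zs. real (length zs) \<le> K1 * R powr s \<and>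
    (\<forall>f\<in>set fs. log_deriv_controlled zs R (K1 * R powr (s - 1)) f)"
    using Cons.IH Cons.prems by auto
  obtain K2 where K2: "0 \<le> K2" "\<And>R. 1 \<le> R \<Longrightarrow> \<exists>zs. set zs = {z \<in> cball 0 (4 * R). f z = 0} \<and>
    real (length zs) \<le> K2 * R powr s \<and> log_deriv_controlled zs R (K2 * R powr (s - 1)) f"
    using growth_le_log_deriv_controlled_single[of f s] Cons.prems[of f] s by auto
  show ?case
  proof (intro exI[of _ "K1 + K2"] conjI allI impI)
    fix R :: real assume R: "1 \<le> R"
    obtain zs1 where zs1: "real (length zs1) \<le> K1 * R powr s"
      "\<And>f. f \<in> set fs \<Longrightarrow> log_deriv_controlled zs1 R (K1 * R powr (s - 1)) f"
      using K1(2)[OF R] by blast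
    obtain zs2 where zs2: "real (length zs2) \<le> K2 * R powr s"
      "log_deriv_controlled zs2 R (K2 * R powr (s - 1)) f"
      using K2(2)[OF R] by blast
    show "\<exists>zs. real (length zs) \<le> (K1 + K2) * R powr s \<and>
      (\<forall>f\<in>set (f # fs). log_deriv_controlled zs R ((K1 + K2) * R powr (s - 1)) f)"
    proof (intro exI[of _ "zs2 @ zs1"] conjI ballI)
      show "real (length (zs2 @ zs1)) \<le> (K1 + K2) * R powr s"
        using zs1(1) zs2(1) by (simp add: distrib_right)
      fix h assume "h \<in> set (f # fs)"
      then consider "h = f" | "h \<in> set fs" by auto
      then show "log_deriv_controlled (zs2 @ zs1) R ((K1 + K2) * R powr (s - 1)) h"
      proof cases
        case 1
        show ?thesis unfolding 1
          by (rule log_deriv_controlled_mono[OF zs2(2)])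
             (use K1(1) in \<open>auto intro!: sum_list_nonneg mult_right_mono\<close>)
      next
        case 2
        show ?thesis
          by (rule log_deriv_controlled_mono[OF zs1(2)[OF 2]])
             (use K2(1) in \<open>auto intro!: sum_list_nonneg mult_right_mono\<close>)
      qed
    qed
  qed (use K1 K2 in simp)
qed

text \<open>Since |z - w| is at least the difference of the moduli, a radius far from the moduli of
  all exceptional points is good for the whole circle. With n of order R^s such points, the radius
  chosen by averaging yields n log n / R, which is of order R^(s - 1) (1 + log R).\<close>

lemma growth_le_good_circles:
  assumes fs: "\<And>f. f \<in> set fs \<Longrightarrow> f holomorphic_on UNIV \<and> growth_le s f \<and> f 0 \<noteq> 0" and s: "0 \<le> s"
  obtains K where "0 \<le> K"
    "\<And>R. 1 \<le> R \<Longrightarrow> \<exists>r. R \<le> r \<and> r \<le> 2 * R \<and> (\<forall>f\<in>set fs. \<forall>z. norm z = r \<longrightarrow> f z \<noteq> 0 \<and>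
      norm (deriv f z) \<le> norm (f z) * (K * R powr (s - 1) * (1 + ln R)) \<and>
      (\<forall>\<eta>. norm \<eta> \<le> R \<longrightarrow> norm (f (z + \<eta>)) \<le> norm (f z) * exp (norm \<eta> * (K * R powr (s - 1) * (1 + ln R)))))"
proof -
  obtain K0 where K0: "0 \<le> K0" "\<And>R. 1 \<le> R \<Longrightarrow> \<exists>zs. real (length zs) \<le> K0 * R powr s \<and>
    (\<forall>f\<in>set fs. log_deriv_controlled zs R (K0 * R powr (s - 1)) f)"
    using growth_le_log_deriv_controlled[OF assms] by blast
  define A where "A = K0 + 2"
  have A: "1 \<le> A" using K0 by (simp add: A_def)
  define K where "K = 8 * A * (1 + ln (2 * A) + s) + K0"
  have lnA: "0 \<le> ln (2 * A)" using A by (intro ln_ge_zero) simp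
  have Knn: "0 \<le> K" using A lnA s K0(1) by (simp add: K_def)
  show ?thesis
  proof (rule that[OF Knn])
    fix R :: real assume R: "1 \<le> R"
    obtain zs where zs: "real (length zs) \<le> K0 * R powr s"
      and ctl: "\<And>f. f \<in> set fs \<Longrightarrow> log_deriv_controlled zs R (K0 * R powr (s - 1)) f"
      using K0(2)[OF R] by blast
    have Rs: "1 \<le> R powr s" using R s by (rule ge_one_powr_ge_zero)
    \<comment> \<open>The summand 1 keeps \<open>n\<close> positive also when \<open>K0\<close> is
      0; together with rounding up it explains the 2 in \<open>A\<close>.\<close>
    define n where "n = nat \<lceil>K0 * R powr s\<rceil> + 1"
    have n_ge: "length (map norm zs) \<le> n"
      using zs by (simp add: n_def) linarith
    have nn: "0 < n" by (simp add: n_def)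
    have "0 \<le> K0 * R powr s" using K0 by simp
    then have "real n \<le> K0 * R powr s + 2 * 1" unfolding n_def by linarith
    also have "\<dots> \<le> A * R powr s" unfolding A_def distrib_right by (intro add_left_mono mult_left_mono Rs) auto
    finally have n_le: "real n \<le> A * R powr s" .
    obtain r where r: "R \<le> r" "r \<le> 2 * R" "r \<notin> set (map norm zs)"
      "sum_list (map (\<lambda>t. 1 / \<bar>r - t\<bar>) (map norm zs)) \<le> 8 * real n * (1 + ln (2 * real n)) / R"
      by (rule exists_radius_sum_inverse_dist_le[of R "map norm zs" n]) (use R n_ge nn in auto)
    have lnR: "0 \<le> ln R" using R by simp
    have "ln (2 * real n) \<le> ln (2 * A * R powr s)" using n_le nn by (intro ln_mono) auto
    also have "\<dots> = ln (2 * A) + s * ln R" using A R by (simp add: ln_mult ln_powr)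
    finally have "1 + ln (2 * real n) \<le> 1 + ln (2 * A) + s * ln R" by simp
    also have "\<dots> \<le> (1 + ln (2 * A) + s) * (1 + ln R)"
      using mult_nonneg_nonneg[OF lnA lnR] lnR s by (simp add: algebra_simps)
    finally have ln_n: "1 + ln (2 * real n) \<le> (1 + ln (2 * A) + s) * (1 + ln R)" .
    have "0 \<le> ln (2 * real n)" using nn by (intro ln_ge_zero) simp
    then have "8 * real n * (1 + ln (2 * real n)) / R
        \<le> 8 * (A * R powr s) * ((1 + ln (2 * A) + s) * (1 + ln R)) / R"
      using n_le ln_n A R by (intro divide_right_mono mult_mono) auto
    also have "\<dots> = 8 * A * (1 + ln (2 * A) + s) * R powr (s - 1) * (1 + ln R)"
      using R by (simp add: powr_diff)
    finally have sum1: "sum_list (map (\<lambda>t. 1 / \<bar>r - t\<bar>) (map norm zs)) \<le> 8 * A * (1 + ln (2 * A) + s) * R powr (s - 1) * (1 + ln R)"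
      using r(4) by linarith
    define \<Lambda> where "\<Lambda> = K * R powr (s - 1) * (1 + ln R)"
    have bound: "sum_list (map (\<lambda>w. 1 / norm (z - w)) zs) + K0 * R powr (s - 1) \<le> \<Lambda>" if z: "norm z = r" for z :: complex
    proof -
      have "sum_list (map (\<lambda>w. 1 / norm (z - w)) zs) \<le> sum_list (map (\<lambda>t. 1 / \<bar>r - t\<bar>) (map norm zs))"
        unfolding list.map_comp o_def
      proof (rule sum_list_mono)
        fix w assume w: "w \<in> set zs"
        then have ne: "0 < \<bar>r - norm w\<bar>" using r(3) by auto
        have "\<bar>r - norm w\<bar> \<le> norm (z - w)" using z norm_triangle_ineq3 by blast
        then show "1 / norm (z - w) \<le> 1 / \<bar>r - norm w\<bar>"
          using ne by (intro divide_left_mono mult_pos_pos) auto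
      qed
      moreover have "K0 * R powr (s - 1) * 1 \<le> K0 * R powr (s - 1) * (1 + ln R)"
        using K0(1) lnR by (intro mult_left_mono) auto
      ultimately show ?thesis using sum1 by (simp add: \<Lambda>_def K_def distrib_right)
    qed
    show "\<exists>r. R \<le> r \<and> r \<le> 2 * R \<and> (\<forall>f\<in>set fs. \<forall>z. norm z = r \<longrightarrow> f z \<noteq> 0 \<and>
      norm (deriv f z) \<le> norm (f z) * (K * R powr (s - 1) * (1 + ln R)) \<and>
      (\<forall>\<eta>. norm \<eta> \<le> R \<longrightarrow> norm (f (z + \<eta>)) \<le> norm (f z) * exp (norm \<eta> * (K * R powr (s - 1) * (1 + ln R)))))"
    proof (intro exI[of _ r] conjI ballI allI impI r(1,2))
      fix f and z :: complex assume f: "f \<in> set fs" and z: "norm z = r"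
      note c = ctl[OF f, unfolded log_deriv_controlled_def]
      have zzs: "z \<notin> set zs" using z r(3) by auto
      have "z \<in> cball 0 (4 * R)" using z r(2) R by simp
      then show "f z \<noteq> 0" using c zzs by blast
      have "norm (deriv f z) \<le> norm (f z) * (sum_list (map (\<lambda>w. 1 / norm (z - w)) zs) + K0 * R powr (s - 1))"
        using c z zzs r(2) R by auto
      also have "\<dots> \<le> norm (f z) * \<Lambda>" by (intro mult_left_mono bound z) auto
      finally show "norm (deriv f z) \<le> norm (f z) * (K * R powr (s - 1) * (1 + ln R))" by (simp add: \<Lambda>_def)
      fix \<eta> :: complex assume \<eta>: "norm \<eta> \<le> R"
      have "norm (z + \<eta>) \<le> 3 * R" using z r(2) \<eta> norm_triangle_ineq[of z \<eta>] by linarith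
      then have "norm (f (z + \<eta>)) \<le> norm (f z) * exp (norm \<eta> * (sum_list (map (\<lambda>w. 1 / norm (z - w)) zs) + K0 * R powr (s - 1)))"
        using c z zzs r(2) R by auto
      also have "\<dots> \<le> norm (f z) * exp (norm \<eta> * \<Lambda>)"
        by (intro mult_left_mono iffD2[OF exp_le_cancel_iff] bound z) auto
      finally show "norm (f (z + \<eta>)) \<le> norm (f z) * exp (norm \<eta> * (K * R powr (s - 1) * (1 + ln R)))"
        by (simp add: \<Lambda>_def)
    qed
  qed
qed

text \<open>The pair X, Y may change with T, but Y 0 is always the same nonzero \<open>c\<close>.
  Thus log (M / |Y 0|) is of order T^s uniformly, and the quotient estimate at radius T / 4 gives
  one constant for all points.\<close>

lemma growth_le_quotient:
  assumes F: "F holomorphic_on UNIV" and s: "0 \<le> s" and c: "c \<noteq> 0" and K: "0 \<le> K"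
    and XY: "\<And>T. T0 \<le> T \<Longrightarrow> \<exists>X Y. X holomorphic_on ball 0 T \<and> Y holomorphic_on ball 0 T \<and> Y 0 = c \<and>
      (\<forall>z\<in>ball 0 T. X z = F z * Y z \<and> norm (X z) \<le> exp (K * T powr s) \<and> norm (Y z) \<le> exp (K * T powr s))"
  shows "growth_le s F"
proof -
  define T1 where "T1 = max 1 T0"
  define K' where "K' = K + \<bar>ln (norm c)\<bar> + 1"
  have "norm (F z) \<le> exp (15 * K' * (8 * T1) powr s * (1 + norm z) powr s)" for z
  proof -
    \<comment> \<open>The factor 8 puts z within 7/8 of the radius T / 4, and \<open>T1\<close>
      ensures T \<ge> T0. The product form lets T^s split into a constant and (1 + |z|)^s.\<close>
    define T where "T = 8 * T1 * (1 + norm z)"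
    have T1: "1 \<le> T1" by (simp add: T1_def)
    have T: "8 * (1 + norm z) \<le> T" "T1 \<le> T"
      using T1 mult_right_mono[OF T1, of "8 * (1 + norm z)"] mult_left_mono[of 1 "8 * (1 + norm z)" T1]
      by (simp_all add: T_def mult_ac)
    have T0: "T0 \<le> T" "0 < T" "1 \<le> T" using T(2) T1 by (auto simp: T1_def)
    obtain X Y where X: "X holomorphic_on ball 0 T" and Y: "Y holomorphic_on ball 0 T" "Y 0 = c"
      and eq: "\<And>z. z \<in> ball 0 T \<Longrightarrow> X z = F z * Y z"
      and le: "\<And>z. z \<in> ball 0 T \<Longrightarrow> norm (X z) \<le> exp (K * T powr s) \<and> norm (Y z) \<le> exp (K * T powr s)"
      using XY[OF T0(1)] by blast
    have Ts: "1 \<le> T powr s" using T0(3) s by (rule ge_one_powr_ge_zero)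
    have "ln (exp (K * T powr s) / norm (Y 0)) = K * T powr s - ln (norm c)"
      using c by (simp add: ln_div Y)
    also have "\<dots> < K * T powr s + (\<bar>ln (norm c)\<bar> + 1) * 1" by simp
    also have "\<dots> \<le> K * T powr s + (\<bar>ln (norm c)\<bar> + 1) * T powr s"
      by (intro add_left_mono mult_left_mono Ts) auto
    also have "\<dots> = K' * T powr s" by (simp add: K'_def algebra_simps)
    finally have L: "ln (exp (K * T powr s) / norm (Y 0)) < K' * T powr s" .
    have "norm (F z) \<le> exp (15 * (K' * T powr s))"
      by (rule norm_quotient_le[of X "T / 4" Y F "exp (K * T powr s)"])
         (use X Y eq le L T T0 c in \<open>auto intro: holomorphic_on_subset[OF F]\<close>)
    also have "T powr s = (8 * T1) powr s * (1 + norm z) powr s"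
      unfolding T_def by (rule powr_mult)
    finally show ?thesis by (simp add: mult_ac)
  qed
  then show ?thesis unfolding growth_le_def by blast
qed

subsection \<open>Auxiliary quotients and the Poisson inequality\<close>

text \<open>The poles of H' / H are simple whatever the multiplicities of the zeros of
  \<open>H\<close>, so a single zero of \<open>L\<close> cancels each of them. Sharing without
  multiplicities is therefore enough.\<close>

lemma holomorphic_log_deriv_times:
  fixes H L :: "complex \<Rightarrow> complex"
  assumes H: "H holomorphic_on S" and L: "L holomorphic_on S" and S: "open S" "connected S"
    and nz: "z0 \<in> S" "H z0 \<noteq> 0" and zeros: "\<And>z. z \<in> S \<Longrightarrow> H z = 0 \<Longrightarrow> L z = 0"
  obtains q where "q holomorphic_on S" "\<And>z. z \<in> S \<Longrightarrow> deriv H z * L z = q z * H z"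
proof -
  define q0 where "q0 = (\<lambda>z. deriv H z * L z / H z)"
  have dH: "deriv H holomorphic_on S" by (rule holomorphic_deriv[OF H S(1)])
  have q0_an: "q0 analytic_on {p}" if "p \<in> S" "H p \<noteq> 0" for p
    unfolding q0_def using that
    by (intro analytic_intros holomorphic_on_imp_analytic_at[OF _ S(1)] H L dH) auto
  have "remove_sings q0 analytic_on {p}" if p: "p \<in> S" for p
  proof (cases "H p = 0")
    case False
    then show ?thesis using q0_an[OF p] by (intro remove_sings_analytic_on)
  next
    case True
    have "\<not> H constant_on S" using True p nz by (metis constant_on_def)
    then obtain g r n where g: "0 < n" "0 < r" "ball p r \<subseteq> S" "g holomorphic_on ball p r"
      "\<And>w. w \<in> ball p r \<Longrightarrow> H w = (w - p) ^ n * g w" "\<And>w. w \<in> ball p r \<Longrightarrow> g w \<noteq> 0"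
      using holomorphic_factor_zero_nonconstant[OF H S p True] by metis
    define l where "l = (\<lambda>w. if w = p then deriv L p else (L w - L p) / (w - p))"
    have l: "l holomorphic_on ball p r"
      unfolding l_def by (rule pole_lemma) (use g(2,3) in \<open>auto intro: holomorphic_on_subset[OF L]\<close>)
    \<comment> \<open>With H = (w - p)^n g, the quotient H' L / H is n L / (w - p) + g' L / g. The
      first term extends across p as n times the difference quotient \<open>l\<close>, because L p =
      0.\<close>
    define q where "q = (\<lambda>w. of_nat n * l w + deriv g w * L w / g w)"
    have "q holomorphic_on ball p r"
      unfolding q_def using g(3,4,6)
      by (intro holomorphic_intros l holomorphic_deriv holomorphic_on_subset[OF L]) auto
    then have "continuous_on (ball p r) q" by (rule holomorphic_on_imp_continuous_on)
    then have "isCont q p" using g(2) by (simp add: continuous_on_eq_continuous_at)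
    have q_eq: "q0 w = q w" if w: "w \<in> ball p r - {p}" for w
    proof -
      have Hw: "H w = (w - p) ^ n * g w" and gw: "g w \<noteq> 0" and wp: "w - p \<noteq> 0" using w g by auto
      have "((\<lambda>w. (w - p) ^ n * g w) has_field_derivative
          of_nat n * (w - p) ^ (n - 1) * g w + deriv g w * (w - p) ^ n) (at w)"
        using holomorphic_derivI[OF g(4) open_ball, of w] w
        by (auto intro!: derivative_eq_intros)
      then have "(H has_field_derivative of_nat n * (w - p) ^ (n - 1) * g w + deriv g w * (w - p) ^ n) (at w)"
        by (rule has_field_derivative_transform_within_open[where S = "ball p r"]) (use w g(5) in auto)
      then have "deriv H w = of_nat n * (w - p) ^ (n - 1) * g w + deriv g w * (w - p) ^ n"
        by (rule DERIV_imp_deriv)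
      moreover have "(w - p) ^ n = (w - p) * (w - p) ^ (n - 1)"
        using g(1) by (cases n) auto
      moreover have "L p = 0" using zeros p True by auto
      moreover have "(of_nat n * X * G + G' * (D * X)) * A / (D * X * G) = of_nat n * (A / D) + G' * A / G"
        if "D \<noteq> 0" "X \<noteq> 0" "G \<noteq> 0" for A D G G' X :: complex
        using that by (simp add: field_simps)
      moreover have "(w - p) ^ (n - 1) \<noteq> 0" using wp by simp
      moreover have "q w = of_nat n * (L w / (w - p)) + deriv g w * L w / g w"
        using wp \<open>L p = 0\<close> by (simp add: q_def l_def)
      ultimately show ?thesis
        using wp gw unfolding q0_def Hw by metis
    qed
    have "q0 analytic_on ball p r - {p}"
      by (rule iffD2[OF analytic_on_analytic_at]) (use g(3,5,6) in \<open>auto intro!: q0_an\<close>)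
    then have "isolated_singularity_at q0 p"
      using g(2) by (auto simp: isolated_singularity_at_def)
    moreover have "(q0 \<longlongrightarrow> q p) (at p)"
    proof (rule Lim_transform_eventually)
      show "(q \<longlongrightarrow> q p) (at p)" using \<open>isCont q p\<close> by (simp add: isCont_def)
      have "eventually (\<lambda>w. w \<in> ball p r - {p}) (at p)"
        using g(2) by (intro eventually_at_in_open) auto
      then show "eventually (\<lambda>w. q w = q0 w) (at p)"
        by eventually_elim (use q_eq in auto)
    qed
    ultimately show ?thesis by (rule remove_sings_analytic_at)
  qed
  then have "remove_sings q0 analytic_on S" using analytic_on_analytic_at by blast
  then have "remove_sings q0 holomorphic_on S" by (rule analytic_imp_holomorphic)
  moreover have "deriv H z * L z = remove_sings q0 z * H z" if "z \<in> S" for z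
    using zeros[OF that] q0_an[OF that] by (cases "H z = 0") (auto simp: q0_def)
  ultimately show ?thesis by (rule that)
qed

section \<open>Poisson's formula and the passage from finite order to a pointwise bound\<close>

lemma poisson_kernel_bounds:
  assumes "norm u = R" "norm z < R"
  shows "0 \<le> (R\<^sup>2 - (norm z)\<^sup>2) / (norm (u - z))\<^sup>2"
    "(R\<^sup>2 - (norm z)\<^sup>2) / (norm (u - z))\<^sup>2 \<le> (R + norm z) / (R - norm z)"
proof -
  have sq: "(norm z)\<^sup>2 \<le> R\<^sup>2" using assms by (intro power_mono) auto
  then show "0 \<le> (R\<^sup>2 - (norm z)\<^sup>2) / (norm (u - z))\<^sup>2" by simp
  have "R - norm z \<le> norm (u - z)" using norm_triangle_ineq2[of u z] assms by simp
  then have "(R - norm z)\<^sup>2 \<le> (norm (u - z))\<^sup>2" using assms by (intro power_mono) auto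
  moreover have "0 < (R - norm z)\<^sup>2" using assms by simp
  ultimately have "(R\<^sup>2 - (norm z)\<^sup>2) / (norm (u - z))\<^sup>2 \<le> (R\<^sup>2 - (norm z)\<^sup>2) / (R - norm z)\<^sup>2"
    using sq by (intro divide_left_mono mult_pos_pos) (auto simp del: zero_less_power2)
  also have "\<dots> = (R + norm z) / (R - norm z)"
    using assms by (simp add: power2_eq_square square_diff_square_factored)
  finally show "(R\<^sup>2 - (norm z)\<^sup>2) / (norm (u - z))\<^sup>2 \<le> (R + norm z) / (R - norm z)" .
qed

text \<open>Cauchy's formula for \<open>w \<mapsto> H w (R\<^sup>2 - |z|\<^sup>2) / (R\<^sup>2 - cnj z w)\<close>, which takes the value \<open>H z\<close> at \<open>z\<close>.\<close>
lemma poisson_formula: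
  assumes H: "H holomorphic_on cball 0 R" and z: "norm z < R"
  shows "((\<lambda>t. Re (H (of_real R * cis t)) * ((R\<^sup>2 - (norm z)\<^sup>2) / (norm (of_real R * cis t - z))\<^sup>2))
    has_integral 2 * pi * Re (H z)) {0..2 * pi}"
proof -
  have R: "0 < R" using z by (meson norm_ge_zero le_less_trans)
  define F where "F = (\<lambda>w. H w * (of_real (R\<^sup>2 - (norm z)\<^sup>2)) / (of_real (R\<^sup>2) - cnj z * w))"
  have den: "of_real (R\<^sup>2) - cnj z * w \<noteq> 0" if "norm w \<le> R" for w
  proof
    assume "of_real (R\<^sup>2) - cnj z * w = 0"
    then have "norm (of_real (R\<^sup>2) :: complex) = norm (cnj z * w)" by simp
    then have "R * R = norm z * norm w" by (simp add: norm_mult power2_eq_square)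
    moreover have "norm z * norm w \<le> norm z * R" using that by (intro mult_left_mono) auto
    moreover have "norm z * R < R * R" using z R by simp
    ultimately show False by linarith
  qed
  have "F holomorphic_on cball 0 R"
    unfolding F_def by (intro holomorphic_intros H) (use den in auto)
  then have "((\<lambda>u. F u / (u - z)) has_contour_integral (2 * of_real pi * \<i> * F z)) (circlepath 0 R)"
    by (rule Cauchy_integral_circlepath_simple) (use z in simp)
  then have "((\<lambda>t. F (0 + of_real R * cis t) / (0 + of_real R * cis t - z) * of_real R * \<i> * cis t)
      has_integral (2 * of_real pi * \<i> * F z)) {0..2 * pi}"
    by (simp add: circlepath_def has_contour_integral_part_circlepath_iff)
  then have "((\<lambda>t. (- \<i>) * (F (0 + of_real R * cis t) / (0 + of_real R * cis t - z) * of_real R * \<i> * cis t))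
      has_integral (- \<i>) * (2 * of_real pi * \<i> * F z)) {0..2 * pi}"
    by (rule has_integral_mult_right)
  then have "(Re \<circ> (\<lambda>t. (- \<i>) * (F (0 + of_real R * cis t) / (0 + of_real R * cis t - z) * of_real R * \<i> * cis t))
      has_integral Re ((- \<i>) * (2 * of_real pi * \<i> * F z))) {0..2 * pi}"
    by (rule has_integral_linear) (rule bounded_linear_Re)
  moreover have "F z = H z"
  proof -
    have "of_real (R\<^sup>2 - (norm z)\<^sup>2) = of_real (R\<^sup>2) - cnj z * z"
      by (simp only: of_real_diff complex_norm_square mult.commute)
    then show ?thesis using den[of z] z by (simp add: F_def)
  qed
  moreover have "(- \<i>) * (F (0 + of_real R * cis t) / (0 + of_real R * cis t - z) * of_real R * \<i> * cis t)
      = H (of_real R * cis t) * of_real ((R\<^sup>2 - (norm z)\<^sup>2) / (norm (of_real R * cis t - z))\<^sup>2)" for t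
  proof -
    define u where "u = of_real R * cis t"
    have u: "norm u = R" "u \<noteq> 0" "u \<noteq> z" using R z by (auto simp: u_def norm_mult)
    have "of_real (R\<^sup>2) = u * cnj u" using u(1) by (metis complex_norm_square of_real_power)
    then have "(of_real (R\<^sup>2) - cnj z * u) * (u - z) = u * ((u - z) * cnj (u - z))"
      by (simp add: algebra_simps)
    also have "(u - z) * cnj (u - z) = of_real ((norm (u - z))\<^sup>2)"
      by (metis complex_norm_square of_real_power)
    finally have *: "(of_real (R\<^sup>2) - cnj z * u) * (u - z) = u * of_real ((norm (u - z))\<^sup>2)" .
    have i_cancel: "(- \<i>) * (A * \<i>) = A" for A
      by (simp add: complex_eq_iff)
    have "(- \<i>) * (F u / (u - z) * u * \<i>)
      = H u * of_real (R\<^sup>2 - (norm z)\<^sup>2) * u / ((of_real (R\<^sup>2) - cnj z * u) * (u - z))"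
      unfolding F_def i_cancel by simp
    also have "\<dots> = H u * of_real ((R\<^sup>2 - (norm z)\<^sup>2) / (norm (u - z))\<^sup>2)"
      unfolding * using u by simp
    finally show ?thesis by (simp add: u_def mult_ac)
  qed
  ultimately have "((\<lambda>t. Re (H (of_real R * cis t) * of_real ((R\<^sup>2 - (norm z)\<^sup>2) / (norm (of_real R * cis t - z))\<^sup>2)))
      has_integral Re ((- \<i>) * (2 * of_real pi * \<i> * H z))) {0..2 * pi}"
    by (simp only: o_def)
  moreover have "Re (A * of_real x) = Re A * x" for A x by simp
  moreover have "Re ((- \<i>) * (2 * of_real pi * \<i> * H z)) = 2 * pi * Re (H z)" by simp
  ultimately show ?thesis by (simp only:)
qed

text \<open>In this form the argument of the logarithm is at least 1, so continuity along a circle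
  is clear even if the circle meets zeros of the function.\<close>

lemma log_plus_eq: "0 \<le> x \<Longrightarrow> log_plus x = ln (max 1 x)"
  by (cases "x = 0") (auto simp: log_plus_def max_def)

lemma continuous_on_log_plus_circle:
  assumes "f holomorphic_on UNIV"
  shows "continuous_on {0..2 * pi} (\<lambda>t. log_plus (norm (f (of_real R * cis t))))"
proof -
  have f: "continuous_on UNIV f" using assms by (rule holomorphic_on_imp_continuous_on)
  have "continuous_on {0..2 * pi} (\<lambda>t. f (of_real R * cis t))"
    by (rule continuous_on_compose2[OF f]) (auto intro!: continuous_intros)
  then have "continuous_on {0..2 * pi} (\<lambda>t. ln (max 1 (norm (f (of_real R * cis t)))))"
    by (intro continuous_intros) auto
  then show ?thesis by (simp add: log_plus_eq)
qed

text \<open>Replacing each zero inside the disc by its reflection at the circle does not change the modulus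
  on the circle and increases it inside; the result has a holomorphic logarithm.\<close>
lemma ln_norm_le_proximity:
  assumes f: "f holomorphic_on UNIV" and z: "norm z < R" and fz: "f z \<noteq> 0"
    and sph: "\<And>u. norm u = R \<Longrightarrow> f u \<noteq> 0"
  shows "ln (norm (f z)) \<le> (R + norm z) / (R - norm z) * proximity f R"
proof -
  have R: "0 < R" using z by (meson norm_ge_zero le_less_trans)
  obtain zs g where zs: "set zs = {w \<in> cball 0 R. f w = 0}" and g: "g holomorphic_on UNIV"
    and fac: "\<And>w. w \<in> UNIV \<Longrightarrow> f w = prod_list (map (\<lambda>v. w - v) zs) * g w"
    and gnz: "\<And>w. w \<in> cball 0 R \<Longrightarrow> g w \<noteq> 0"
    by (rule holomorphic_factor_zeros[OF f, of "cball 0 R" z]) (use fz in auto)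
  have zs_lt: "norm v < R" if "v \<in> set zs" for v
    using that sph[of v] unfolding zs by force
  define b where "b = (\<lambda>v w. (of_real (R\<^sup>2) - cnj v * w) / of_real R)"
  define B where "B = (\<lambda>w. prod_list (map (\<lambda>v. b v w) zs))"
  have b_ge: "norm (w - v) \<le> norm (b v w)" and b_eq: "norm w = R \<Longrightarrow> norm (b v w) = norm (w - v)"
    and b_nz: "b v w \<noteq> 0"
    if v: "norm v < R" and w: "norm w \<le> R" for v w
  proof -
    have "(norm (of_real (R\<^sup>2) - cnj v * w))\<^sup>2 - R\<^sup>2 * (norm (w - v))\<^sup>2
      = (R\<^sup>2 - (norm w)\<^sup>2) * (R\<^sup>2 - (norm v)\<^sup>2)"
      unfolding cmod_power2 by (simp add: power2_eq_square algebra_simps)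
    moreover have "(norm (b v w))\<^sup>2 * R\<^sup>2 = (norm (of_real (R\<^sup>2) - cnj v * w))\<^sup>2"
      using R by (simp add: b_def norm_divide power_divide)
    ultimately have eq: "((norm (b v w))\<^sup>2 - (norm (w - v))\<^sup>2) * R\<^sup>2 = (R\<^sup>2 - (norm w)\<^sup>2) * (R\<^sup>2 - (norm v)\<^sup>2)"
      by (simp add: algebra_simps)
    have le: "(norm w)\<^sup>2 \<le> R\<^sup>2" "(norm v)\<^sup>2 < R\<^sup>2"
      using v w by (auto intro!: power_mono power_strict_mono)
    then have "0 \<le> ((norm (b v w))\<^sup>2 - (norm (w - v))\<^sup>2) * R\<^sup>2" unfolding eq by simp
    then have "(norm (w - v))\<^sup>2 \<le> (norm (b v w))\<^sup>2" using R by (simp add: zero_le_mult_iff)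
    then show "norm (w - v) \<le> norm (b v w)" by (rule power2_le_imp_le) simp
    show "norm (b v w) = norm (w - v)" if "norm w = R"
    proof -
      have "((norm (b v w))\<^sup>2 - (norm (w - v))\<^sup>2) * R\<^sup>2 = 0" unfolding eq that by simp
      then have "(norm (b v w))\<^sup>2 = (norm (w - v))\<^sup>2" using R by simp
      then show ?thesis by (simp add: power2_eq_iff_nonneg)
    qed
    have "norm (cnj v * w) \<le> norm v * R" unfolding norm_mult using w by (simp add: mult_left_mono)
    also have "\<dots> < R * R" using v R by simp
    also have "R * R = norm (of_real (R\<^sup>2) :: complex)" by (simp add: power2_eq_square norm_mult)
    finally have "of_real (R\<^sup>2) \<noteq> cnj v * w" by (metis less_irrefl)
    then show "b v w \<noteq> 0" using R by (simp add: b_def)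
  qed
  define k where "k = (\<lambda>w. B w * g w)"
  have "B holomorphic_on UNIV"
    unfolding B_def b_def using R by (induction zs) (auto intro!: holomorphic_intros)
  then have k: "k holomorphic_on UNIV" unfolding k_def by (intro holomorphic_intros g)
  have B_nz: "B w \<noteq> 0" if "norm w \<le> R" for w
    using b_nz[OF zs_lt that] by (auto simp: B_def prod_list_zero_iff)
  have k_nz: "k w \<noteq> 0" if "norm w \<le> R" for w
    using B_nz[OF that] gnz[of w] that by (simp add: k_def)
  have k_ge: "norm (f w) \<le> norm (k w)" if w: "norm w \<le> R" for w
  proof -
    have "prod_list (map (\<lambda>v. norm (w - v)) zs) \<le> prod_list (map (\<lambda>v. norm (b v w)) zs)"
      if "\<And>v. v \<in> set zs \<Longrightarrow> norm v < R" for zs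
      using that by (induction zs) (auto intro!: mult_mono b_ge w prod_list_nonneg)
    then show ?thesis
      using zs_lt fac[of w] by (simp add: k_def B_def norm_mult norm_prod_list mult_right_mono)
  qed
  have k_eq: "norm (k w) = norm (f w)" if w: "norm w = R" for w
  proof -
    have "map (\<lambda>v. norm (w - v)) zs = map (\<lambda>v. norm (b v w)) zs"
      using b_eq[OF zs_lt _ w] w by auto
    then have "prod_list (map (\<lambda>v. norm (w - v)) zs) = prod_list (map (\<lambda>v. norm (b v w)) zs)"
      by (rule arg_cong)
    then show ?thesis using fac[of w] by (simp add: k_def B_def norm_mult norm_prod_list)
  qed
  \<comment> \<open>Poisson's formula is applied to a logarithm of \<open>k\<close> on the closed
    disc, hence \<open>k\<close> must be zero-free on a larger open disc. If \<open>k\<close> has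
    zeros with modulus at most R + 1, the smallest such modulus serves as \<open>R'\<close>.\<close>
  obtain R' where R': "R < R'" "\<And>w. norm w < R' \<Longrightarrow> k w \<noteq> 0"
  proof (cases "{w \<in> cball 0 (R + 1). k w = 0} = {}")
    case True
    then show ?thesis by (intro that[of "R + 1"]) auto
  next
    case False
    have "closed (cball 0 (R + 1) \<inter> k -` {0})"
      using k by (intro continuous_closed_preimage)
        (auto intro: holomorphic_on_imp_continuous_on holomorphic_on_subset)
    moreover have "{w \<in> cball 0 (R + 1). k w = 0} = cball 0 (R + 1) \<inter> k -` {0}" by auto
    moreover have "bounded {w \<in> cball 0 (R + 1). k w = 0}" by (rule bounded_subset[OF bounded_cball[of 0 "R + 1"]]) auto
    ultimately have "compact {w \<in> cball 0 (R + 1). k w = 0}" by (simp add: compact_eq_bounded_closed)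
    then obtain m where m: "m \<in> {w \<in> cball 0 (R + 1). k w = 0}"
      "\<And>w. w \<in> {w \<in> cball 0 (R + 1). k w = 0} \<Longrightarrow> norm m \<le> norm w"
      using continuous_attains_inf[OF _ False continuous_on_norm_id] by auto
    show ?thesis
    proof (rule that[of "norm m"])
      show "R < norm m" using m(1) k_nz[of m] by force
      show "k w \<noteq> 0" if "norm w < norm m" for w
        using m(1) m(2)[of w] that by force
    qed
  qed
  obtain H where H: "H holomorphic_on ball 0 R'" "\<And>w. w \<in> ball 0 R' \<Longrightarrow> exp (H w) = k w"
    by (rule holomorphic_logarithm_exists[of "ball 0 R'" k 0])
       (use R R' in \<open>auto intro: holomorphic_on_subset[OF k]\<close>)
  have Re_H: "Re (H w) = ln (norm (k w))" if "norm w \<le> R" for w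
    using H(2)[of w] that R' by (metis le_less_trans ln_exp mem_ball_0 norm_exp_eq_Re)
  define P where "P = (\<lambda>t. (R\<^sup>2 - (norm z)\<^sup>2) / (norm (of_real R * cis t - z))\<^sup>2)"
  define C where "C = (R + norm z) / (R - norm z)"
  define lp where "lp = (\<lambda>t. log_plus (norm (f (of_real R * cis t))))"
  have lp: "(lp has_integral integral {0..2 * pi} lp) {0..2 * pi}"
    unfolding lp_def
    by (intro integrable_integral integrable_continuous_interval continuous_on_log_plus_circle f)
  have lp_nonneg: "0 \<le> lp t" for t by (simp add: lp_def log_plus_def)
  have Pb: "0 \<le> P t" "P t \<le> C" for t
    using poisson_kernel_bounds[of "of_real R * cis t" R z] z R by (auto simp: P_def C_def norm_mult)
  have "2 * pi * Re (H z) \<le> C * integral {0..2 * pi} lp"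
  proof (rule has_integral_le)
    show "((\<lambda>t. Re (H (of_real R * cis t)) * P t) has_integral 2 * pi * Re (H z)) {0..2 * pi}"
      unfolding P_def
      by (rule poisson_formula[OF holomorphic_on_subset[OF H(1)] z]) (use R' in auto)
    show "((\<lambda>t. C * lp t) has_integral C * integral {0..2 * pi} lp) {0..2 * pi}"
      by (rule has_integral_mult_right[OF lp])
    fix t
    have nt: "norm (of_real R * cis t) = R" using R by (simp add: norm_mult)
    have "Re (H (of_real R * cis t)) = ln (norm (f (of_real R * cis t)))"
      using Re_H k_eq nt by simp
    also have "\<dots> \<le> lp t" by (simp add: lp_def log_plus_def)
    finally have "Re (H (of_real R * cis t)) * P t \<le> lp t * P t"
      using Pb(1) by (rule mult_right_mono)
    also have "\<dots> \<le> lp t * C" using Pb(2) lp_nonneg by (intro mult_left_mono) auto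
    finally show "Re (H (of_real R * cis t)) * P t \<le> C * lp t" by (simp add: mult.commute)
  qed
  moreover have "integral {0..2 * pi} lp = 2 * pi * proximity f R"
    by (simp add: proximity_def lp_def)
  ultimately have "2 * pi * Re (H z) \<le> 2 * pi * (C * proximity f R)"
    by (simp only: mult.left_commute)
  then have "Re (H z) \<le> C * proximity f R" by simp
  moreover have "ln (norm (f z)) \<le> Re (H z)"
    using k_ge[of z] Re_H[of z] z fz by (simp add: ln_mono)
  ultimately show ?thesis by (simp add: C_def)
qed

text \<open>Finite order gives m(r, f) \<le> r^n for large r. The Poisson inequality at a radius R
  \<ge> 2 |z| comparable to 1 + |z| turns this into a pointwise bound; there the factor (R + |z|) /
  (R - |z|) is at most 3.\<close>

lemma growth_le_of_order_finite:
  assumes f: "f holomorphic_on UNIV" and nz: "f p \<noteq> 0" and ord: "order_entire f < \<infinity>"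
  obtains n :: nat where "growth_le (real n) f"
proof -
  obtain n :: nat where "order_entire f < ereal (real n)"
    using ord less_PInf_Ex_of_nat[of "order_entire f"] by auto
  then have "eventually (\<lambda>r. ereal (log_plus (nevanlinna_T_entire r f) / ln r) < ereal (real n)) at_top"
    unfolding order_entire_def by (rule Limsup_lessD)
  then obtain r0 where r0: "\<And>r. r0 \<le> r \<Longrightarrow> log_plus (proximity f r) / ln r < real n"
    by (auto simp: eventually_at_top_linorder nevanlinna_T_entire_def)
  have prox: "proximity f r \<le> r ^ n" if "r0 \<le> r" "1 < r" for r
  proof (cases "0 < proximity f r")
    case True
    have "ln (proximity f r) \<le> log_plus (proximity f r)" by (simp add: log_plus_def)
    also have "\<dots> \<le> real n * ln r" using r0[OF that(1)] that(2) by (simp add: divide_less_eq)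
    also have "\<dots> = ln (r ^ n)" using that by (simp add: ln_realpow)
    finally show ?thesis using True that by (subst (asm) ln_le_cancel_iff) auto
  next
    case False
    moreover have "0 \<le> r ^ n" using that by simp
    ultimately show ?thesis by linarith
  qed
  define r1 where "r1 = max r0 1 + 1"
  have r1: "1 < r1" "r0 \<le> r1" by (auto simp: r1_def)
  have "norm (f z) \<le> exp (3 * (3 * r1) ^ n * (1 + norm z) powr real n)" for z
  proof (cases "f z = 0")
    case False
    define \<rho> where "\<rho> = r1 * (1 + norm z)"
    have \<rho>: "r1 \<le> \<rho>" "norm z \<le> \<rho>"
      using r1 mult_left_mono[of 1 "1 + norm z" r1] mult_right_mono[of 1 r1 "1 + norm z"]
      by (auto simp: \<rho>_def)
    \<comment> \<open>The Poisson inequality needs a circle free of zeros. Only finitely many moduli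
      are excluded from the interval of admissible radii.\<close>
    have "finite {w \<in> cball 0 (3 * \<rho>). f w = 0}"
    proof (cases "f constant_on UNIV")
      case True
      then show ?thesis using nz by (auto simp: constant_on_def)
    next
      case False
      show ?thesis
        by (rule holomorphic_compact_finite_zeros[OF f]) (use False in auto)
    qed
    then have "finite (norm ` {w \<in> cball 0 (3 * \<rho>). f w = 0})" by simp
    moreover have "infinite {2 * \<rho>..3 * \<rho>}" using \<rho> r1 by (simp add: infinite_Icc)
    ultimately have "infinite ({2 * \<rho>..3 * \<rho>} - norm ` {w \<in> cball 0 (3 * \<rho>). f w = 0})"
      by (rule Diff_infinite_finite)
    then obtain R where "R \<in> {2 * \<rho>..3 * \<rho>} - norm ` {w \<in> cball 0 (3 * \<rho>). f w = 0}"
      using infinite_imp_nonempty by blast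
    then have R: "R \<in> {2 * \<rho>..3 * \<rho>}" "R \<notin> norm ` {w \<in> cball 0 (3 * \<rho>). f w = 0}" by auto
    have sph: "f u \<noteq> 0" if "norm u = R" for u
      using R that by auto
    have Rz: "norm z < R" "2 * norm z \<le> R" "r0 \<le> R" "1 < R" using R(1) \<rho> r1 by auto
    have "ln (norm (f z)) \<le> (R + norm z) / (R - norm z) * proximity f R"
      by (rule ln_norm_le_proximity[OF f Rz(1) False sph])
    also have "\<dots> \<le> (R + norm z) / (R - norm z) * R ^ n"
      using Rz by (intro mult_left_mono prox) auto
    also have "\<dots> \<le> 3 * (3 * \<rho>) ^ n"
      using Rz R(1) by (intro mult_mono power_mono) (auto simp: divide_le_eq)
    also have "\<dots> = 3 * (3 * r1) ^ n * (1 + norm z) powr real n"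
      by (simp add: \<rho>_def powr_realpow add_pos_nonneg power_mult_distrib)
    finally have "exp (ln (norm (f z))) \<le> exp (3 * (3 * r1) ^ n * (1 + norm z) powr real n)"
      by (simp only: exp_le_cancel_iff)
    moreover have "exp (ln (norm (f z))) = norm (f z)" using False by simp
    ultimately show ?thesis by simp
  qed simp
  then have "growth_le (real n) f" unfolding growth_le_def by blast
  then show ?thesis by (rule that)
qed

subsection \<open>The descent\<close>

lemma open_nonzero:
  fixes h :: "complex \<Rightarrow> complex"
  assumes "h holomorphic_on S" "open S"
  shows "open {z \<in> S. h z \<noteq> 0}"
  using continuous_open_preimage[OF holomorphic_on_imp_continuous_on[OF assms(1)] assms(2), of "- {0}"]
  by (simp add: vimage_def Int_def open_Compl)

lemma entire_nonzero_in_open: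
  fixes h :: "complex \<Rightarrow> complex"
  assumes h: "h holomorphic_on S" "open S" "connected S" "z0 \<in> S" "h z0 \<noteq> 0"
    and U: "open U" "U \<noteq> {}" "U \<subseteq> S"
  obtains z where "z \<in> U" "h z \<noteq> 0"
proof -
  have False if "\<forall>z\<in>U. h z = 0"
    using analytic_continuation_open[OF U(1) h(2) U(2) h(3) U(3) h(1), of "\<lambda>_. 0" z0] that h by simp
  then show ?thesis using that by blast
qed

text \<open>Holomorphic functions on a connected open set have no zero divisors: the equation holds
  on the nonempty open set where F is nonzero and extends by the identity theorem.\<close>

lemma holomorphic_cancel:
  fixes F A B :: "complex \<Rightarrow> complex"
  assumes F: "F holomorphic_on S" "open S" "connected S" "z0 \<in> S" "F z0 \<noteq> 0"
    and A: "A holomorphic_on S" and B: "B holomorphic_on S"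
    and eq: "\<And>z. z \<in> S \<Longrightarrow> F z * A z = F z * B z" and z: "z \<in> S"
  shows "A z = B z"
proof -
  have "open {w \<in> S. F w \<noteq> 0}" by (rule open_nonzero[OF F(1,2)])
  then show ?thesis
    by (rule analytic_continuation_open[OF _ F(2) _ F(3) _ A B _ z]) (use F eq in auto)
qed

text \<open>Elimination of \<open>G\<close> from \<open>U G = W F + a \<psi>\<close>, \<open>W = \<psi> - U\<close>, and its derivative.\<close>
lemma eliminate_second_function:
  fixes F G P U V \<psi> :: "complex \<Rightarrow> complex"
  assumes S: "open S" and holo: "F holomorphic_on S" "G holomorphic_on S" "U holomorphic_on S" "\<psi> holomorphic_on S"
    and F: "\<And>z. z \<in> S \<Longrightarrow> deriv F z * P z = U z * F z"
    and G: "\<And>z. z \<in> S \<Longrightarrow> deriv G z * P z = V z * G z"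
    and rel: "\<And>z. z \<in> S \<Longrightarrow> U z * G z = (\<psi> z - U z) * F z + a * \<psi> z"
    and z: "z \<in> S"
  shows "F z * ((deriv U z * P z + U z * V z - (U z)\<^sup>2) * (\<psi> z - U z) - U z * P z * (deriv \<psi> z - deriv U z))
    = a * (U z * P z * deriv \<psi> z - (deriv U z * P z + U z * V z) * \<psi> z)"
proof -
  note d = holomorphic_derivI[OF _ S z]
  have "((\<lambda>z. U z * G z) has_field_derivative deriv U z * G z + deriv G z * U z) (at z)"
    by (intro DERIV_mult d holo)
  moreover have "((\<lambda>z. (\<psi> z - U z) * F z + a * \<psi> z) has_field_derivative
      ((deriv \<psi> z - deriv U z) * F z + deriv F z * (\<psi> z - U z)) + a * deriv \<psi> z) (at z)"
    by (intro DERIV_mult DERIV_add DERIV_diff DERIV_cmult d holo)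
  then have "((\<lambda>z. U z * G z) has_field_derivative
      ((deriv \<psi> z - deriv U z) * F z + deriv F z * (\<psi> z - U z)) + a * deriv \<psi> z) (at z)"
    by (rule has_field_derivative_transform_within_open[OF _ S z]) (simp add: rel)
  ultimately have rel': "deriv U z * G z + deriv G z * U z
      = ((deriv \<psi> z - deriv U z) * F z + deriv F z * (\<psi> z - U z)) + a * deriv \<psi> z"
    by (rule DERIV_unique)
  show ?thesis
    using F[OF z] G[OF z] rel[OF z] rel' by algebra
qed

lemma nonconstant_deriv_nonzero:
  fixes f :: "complex \<Rightarrow> complex"
  assumes f: "f holomorphic_on UNIV" and nc: "f z1 \<noteq> f z2"
  obtains w where "deriv f w \<noteq> 0"
proof (rule ccontr)
  assume "\<not> thesis"
  then have "deriv f w = 0" for w using that by blast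
  then have "\<exists>c. \<forall>z\<in>UNIV. f z = c"
    using holomorphic_derivI[OF f open_UNIV]
    by (intro has_field_derivative_zero_constant) (auto intro: has_field_derivative_at_within)
  then show False using nc by auto
qed

text \<open>Half a power absorbs the logarithm, since log R is at most 2 R^(1/2) - 2. Of the full
  power gained on good circles, the other half remains as the step of the descent.\<close>

lemma powr_ln_le:
  fixes R s :: real
  assumes "1 \<le> R"
  shows "R powr (s - 1) * (1 + ln R) \<le> 2 * R powr (s - 1 / 2)"
proof -
  have "ln R \<le> 2 * (R powr (1 / 2) - 1)"
    using ln_le_minus_one[of "R powr (1 / 2)"] assms by (simp add: ln_powr)
  then have "R powr (s - 1) * (1 + ln R) \<le> R powr (s - 1) * (2 * R powr (1 / 2))"
    by (intro mult_left_mono) auto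
  also have "\<dots> = 2 * R powr (s - 1 / 2)" using assms by (simp add: powr_add[symmetric])
  finally show ?thesis .
qed

section \<open>The shared pairs, the functions built from them, and their bounds\<close>

text \<open>The equation for \<open>\<phi>\<close> is in product form, so it is meaningful also at
  the zeros of f and f - a. All assumptions are invariant under translation of the variable.\<close>

locale shared_pairs =
  fixes \<eta> a :: complex and f \<phi> :: "complex \<Rightarrow> complex"
  assumes f: "f holomorphic_on UNIV" and \<phi>: "\<phi> holomorphic_on UNIV"
    and \<eta>: "\<eta> \<noteq> 0" and a: "a \<noteq> 0"
    and share_0: "f (z + \<eta>) = f z \<longleftrightarrow> f z = 0"
    and share_a: "f (z + \<eta>) = f z - a \<longleftrightarrow> f z = a"
    and \<phi>_eq: "\<phi> z * f z * (f z - a) = deriv f z * f (z + \<eta>)"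
begin

definition "F z = f z - a"
definition "G z = f (z + \<eta>) - f z + a"
text \<open>This is F' / F, because F' = f'. By the second shared pair F and G have the same zeros,
  so the poles of \<open>u\<close> and of \<open>v\<close> can only be a-points of f.\<close>

definition "u z = deriv f z / F z"
definition "v z = deriv G z / G z"
text \<open>\<open>F D = a E\<close> is the relation of \<open>eliminate_second_function\<close> for \<open>P = 1\<close>, with \<open>D\<close> and \<open>E\<close> made
  of functions of lower growth than \<open>F\<close>.\<close>
definition "D z = (deriv u z + u z * v z - (u z)\<^sup>2) * (\<phi> z - u z) - u z * (deriv \<phi> z - deriv u z)"

lemma f_shift: "(\<lambda>z. f (z + p)) holomorphic_on UNIV"
  by (rule holomorphic_on_compose_gen[OF _ f, unfolded o_def]) (auto intro!: holomorphic_intros)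

lemma F: "F holomorphic_on UNIV"
  unfolding F_def by (intro holomorphic_intros f)

lemma G: "G holomorphic_on UNIV"
  unfolding G_def by (intro holomorphic_intros f f_shift)

lemma deriv_F: "deriv F = deriv f"
proof
  fix z
  have "(f has_field_derivative deriv f z) (at z)" using holomorphic_derivI[OF f open_UNIV] by simp
  then have "(F has_field_derivative deriv f z - 0) (at z)"
    unfolding F_def by (intro DERIV_diff DERIV_const)
  then show "deriv F z = deriv f z" by (simp add: DERIV_imp_deriv)
qed

lemma G_zero_iff: "G z = 0 \<longleftrightarrow> F z = 0"
proof -
  have "G z = f (z + \<eta>) - (f z - a)" by (simp add: G_def)
  then show ?thesis using share_a[of z] by (simp add: F_def)
qed

lemma f_zero_orbit: "f z = 0 \<Longrightarrow> f (z + of_nat n * \<eta>) = 0"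
proof (induction n)
  case (Suc n)
  then have "f (z + of_nat n * \<eta> + \<eta>) = 0" using share_0[of "z + of_nat n * \<eta>"] by simp
  then show ?case by (simp add: algebra_simps)
qed simp

lemma f_zero_after_a: "f z = a \<Longrightarrow> f (z + of_nat (Suc n) * \<eta>) = 0"
proof -
  assume "f z = a"
  then have "f (z + \<eta>) = 0" using share_a[of z] by simp
  then show ?thesis using f_zero_orbit[of "z + \<eta>" n] by (simp add: algebra_simps)
qed

text \<open>Multiply the equation for \<open>\<phi>\<close> by P and replace f' P by U F. A common
  factor F appears; it may vanish inside \<open>S\<close> and is cancelled by the identity
  theorem.\<close>

lemma relation:
  assumes "connected S" "open S" "z0 \<in> S" "F z0 \<noteq> 0" "U holomorphic_on S" "P holomorphic_on S"
    and U: "\<And>z. z \<in> S \<Longrightarrow> deriv f z * P z = U z * F z" and z: "z \<in> S"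
  shows "U z * G z = (\<phi> z * P z - U z) * F z + a * (\<phi> z * P z)"
proof -
  have sub: "F holomorphic_on S" "G holomorphic_on S" "\<phi> holomorphic_on S" "f holomorphic_on S"
    using F G \<phi> f by (auto intro: holomorphic_on_subset)
  show ?thesis
  proof (rule holomorphic_cancel[OF sub(1) assms(2,1,3,4) _ _ _ z])
    fix w assume w: "w \<in> S"
    have "\<phi> w * (F w + a) * F w = deriv f w * (F w + G w)"
      using \<phi>_eq[of w] by (simp add: F_def G_def)
    then show "F w * (U w * G w) = F w * ((\<phi> w * P w - U w) * F w + a * (\<phi> w * P w))"
      using U[OF w] by algebra
  qed (intro holomorphic_intros sub assms)+
qed

text \<open>Lets a suitable point p play the role of 0, where the growth estimates are
  normalised.\<close>

lemma translate: "shared_pairs \<eta> a (\<lambda>z. f (z + p)) (\<lambda>z. \<phi> (z + p))"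
proof
  show "(\<lambda>z. f (z + p)) holomorphic_on UNIV" by (rule f_shift)
  show "(\<lambda>z. \<phi> (z + p)) holomorphic_on UNIV"
    by (rule holomorphic_on_compose_gen[OF _ \<phi>, unfolded o_def]) (auto intro!: holomorphic_intros)
  fix z
  have "((\<lambda>z. f (z + p)) has_field_derivative deriv f (z + p)) (at z)"
    using holomorphic_derivI[OF f open_UNIV, of "z + p" UNIV] by (simp add: DERIV_shift)
  then have "deriv (\<lambda>z. f (z + p)) z = deriv f (z + p)" by (rule DERIV_imp_deriv)
  then show "\<phi> (z + p) * f (z + p) * (f (z + p) - a) = deriv (\<lambda>z. f (z + p)) z * f (z + \<eta> + p)"
    using \<phi>_eq[of "z + p"] by (simp add: add_ac)
  show "f (z + \<eta> + p) = f (z + p) \<longleftrightarrow> f (z + p) = 0"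
    using share_0[of "z + p"] by (simp add: add_ac)
  show "f (z + \<eta> + p) = f (z + p) - a \<longleftrightarrow> f (z + p) = a"
    using share_a[of "z + p"] by (simp add: add_ac)
qed (use \<eta> a in auto)

text \<open>The bound for \<open>\<phi>\<close> comes from writing it as (f' / F) (f (z + \<eta>) /
  f): a logarithmic derivative times a shift quotient, both controlled on a common circle for f, F
  and G.\<close>

lemma good_circles:
  assumes gr: "growth_le s f" and s: "0 \<le> s" and nz: "f 0 \<noteq> 0" "F 0 \<noteq> 0"
  obtains K where "0 \<le> K" "\<And>R. 1 \<le> R \<Longrightarrow> norm \<eta> \<le> R \<Longrightarrow> \<exists>r. R \<le> r \<and> r \<le> 2 * R \<and> (\<forall>z. norm z = r \<longrightarrow>
      F z \<noteq> 0 \<and> G z \<noteq> 0 \<and> norm (deriv f z) \<le> norm (F z) * (K * R powr (s - 1) * (1 + ln R)) \<and>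
      norm (deriv G z) \<le> norm (G z) * (K * R powr (s - 1) * (1 + ln R)) \<and>
      norm (\<phi> z) \<le> (K * R powr (s - 1) * (1 + ln R)) * exp (norm \<eta> * (K * R powr (s - 1) * (1 + ln R))))"
proof -
  have "growth_le s F" unfolding F_def by (intro growth_le_diff growth_le_const s gr)
  moreover have "growth_le s G" unfolding G_def
    by (intro growth_le_diff growth_le_add growth_le_const growth_le_shift s gr)
  moreover have "G 0 \<noteq> 0" using nz G_zero_iff by simp
  ultimately have "g holomorphic_on UNIV \<and> growth_le s g \<and> g 0 \<noteq> 0" if "g \<in> set [f, F, G]" for g
    using that f F G gr nz by auto
  then obtain K where K: "0 \<le> K"
    "\<And>R. 1 \<le> R \<Longrightarrow> \<exists>r. R \<le> r \<and> r \<le> 2 * R \<and> (\<forall>g\<in>set [f, F, G]. \<forall>z. norm z = r \<longrightarrow> g z \<noteq> 0 \<and>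
      norm (deriv g z) \<le> norm (g z) * (K * R powr (s - 1) * (1 + ln R)) \<and>
      (\<forall>\<eta>. norm \<eta> \<le> R \<longrightarrow> norm (g (z + \<eta>)) \<le> norm (g z) * exp (norm \<eta> * (K * R powr (s - 1) * (1 + ln R)))))"
    using growth_le_good_circles[of "[f, F, G]" s] s by blast
  show ?thesis
  proof (rule that[OF K(1)])
    fix R :: real assume R: "1 \<le> R" "norm \<eta> \<le> R"
    define \<Lambda> where "\<Lambda> = K * R powr (s - 1) * (1 + ln R)"
    obtain r where r: "R \<le> r" "r \<le> 2 * R" and b: "\<And>g z. g \<in> set [f, F, G] \<Longrightarrow> norm z = r \<Longrightarrow> g z \<noteq> 0 \<and>
      norm (deriv g z) \<le> norm (g z) * \<Lambda> \<and>
      (\<forall>\<eta>. norm \<eta> \<le> R \<longrightarrow> norm (g (z + \<eta>)) \<le> norm (g z) * exp (norm \<eta> * \<Lambda>))"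
      using K(2)[OF R(1)] unfolding \<Lambda>_def by blast
    show "\<exists>r. R \<le> r \<and> r \<le> 2 * R \<and> (\<forall>z. norm z = r \<longrightarrow>
      F z \<noteq> 0 \<and> G z \<noteq> 0 \<and> norm (deriv f z) \<le> norm (F z) * (K * R powr (s - 1) * (1 + ln R)) \<and>
      norm (deriv G z) \<le> norm (G z) * (K * R powr (s - 1) * (1 + ln R)) \<and>
      norm (\<phi> z) \<le> (K * R powr (s - 1) * (1 + ln R)) * exp (norm \<eta> * (K * R powr (s - 1) * (1 + ln R))))"
      unfolding \<Lambda>_def[symmetric]
    proof (intro exI[of _ r] conjI allI impI r)
      fix z :: complex assume z: "norm z = r"
      show Fz: "F z \<noteq> 0" and "G z \<noteq> 0" using b[of F z] b[of G z] z by auto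
      show dF: "norm (deriv f z) \<le> norm (F z) * \<Lambda>" using b[of F z] z by (simp add: deriv_F)
      show "norm (deriv G z) \<le> norm (G z) * \<Lambda>" using b[of G z] z by simp
      have fz: "f z \<noteq> 0" "norm (f (z + \<eta>)) \<le> norm (f z) * exp (norm \<eta> * \<Lambda>)"
        using b[of f z] z R(2) by auto
      have "norm (\<phi> z) * (norm (f z) * norm (F z)) = norm (deriv f z) * norm (f (z + \<eta>))"
        using arg_cong[OF \<phi>_eq[of z], of norm] by (simp add: F_def norm_mult mult.assoc)
      also have "\<dots> \<le> (norm (F z) * \<Lambda>) * (norm (f z) * exp (norm \<eta> * \<Lambda>))"
        by (intro mult_mono dF fz order_trans[OF norm_ge_zero dF]) auto
      finally have "norm (\<phi> z) * (norm (f z) * norm (F z)) \<le> (\<Lambda> * exp (norm \<eta> * \<Lambda>)) * (norm (f z) * norm (F z))"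
        by (simp add: mult_ac)
      then show "norm (\<phi> z) \<le> \<Lambda> * exp (norm \<eta> * \<Lambda>)"
        using Fz fz(1) by simp
    qed
  qed
qed

text \<open>Here the bound on good circles tends to 0, since R^(-1/2) (1 + log R) does. As the radii
  tend to infinity, the maximum principle forces |\<phi> p| to be 0.\<close>

lemma not_growth_half:
  assumes gr: "growth_le (1 / 2) f" and nz: "f 0 \<noteq> 0" "F 0 \<noteq> 0" and \<phi>0: "\<phi> p \<noteq> 0"
  shows False
proof -
  obtain K where K: "0 \<le> K" "\<And>R. 1 \<le> R \<Longrightarrow> norm \<eta> \<le> R \<Longrightarrow> \<exists>r. R \<le> r \<and> r \<le> 2 * R \<and> (\<forall>z. norm z = r \<longrightarrow>
      F z \<noteq> 0 \<and> G z \<noteq> 0 \<and> norm (deriv f z) \<le> norm (F z) * (K * R powr (1 / 2 - 1) * (1 + ln R)) \<and>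
      norm (deriv G z) \<le> norm (G z) * (K * R powr (1 / 2 - 1) * (1 + ln R)) \<and>
      norm (\<phi> z) \<le> (K * R powr (1 / 2 - 1) * (1 + ln R)) * exp (norm \<eta> * (K * R powr (1 / 2 - 1) * (1 + ln R))))"
    by (rule good_circles[OF gr _ nz]) (simp, blast)
  define \<Lambda> where "\<Lambda> = (\<lambda>R::real. K * (R powr (1 / 2 - 1) * (1 + ln R)))"
  have "((\<lambda>R::real. R powr (1 / 2 - 1) * (1 + ln R)) \<longlongrightarrow> 0) at_top" by real_asymp
  then have \<Lambda>: "(\<Lambda> \<longlongrightarrow> 0) at_top"
    unfolding \<Lambda>_def using tendsto_mult_left[of _ 0 at_top K] by simp
  have "((\<lambda>R. \<Lambda> R * exp (norm \<eta> * \<Lambda> R)) \<longlongrightarrow> 0 * exp (norm \<eta> * 0)) at_top"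
    by (intro tendsto_intros \<Lambda>)
  then have lim: "((\<lambda>R. \<Lambda> R * exp (norm \<eta> * \<Lambda> R)) \<longlongrightarrow> 0) at_top" by simp
  have "eventually (\<lambda>R. norm (\<phi> p) \<le> \<Lambda> R * exp (norm \<eta> * \<Lambda> R)) at_top"
    using eventually_ge_at_top[of "max 1 (max (norm \<eta>) (norm p))"]
  proof eventually_elim
    case (elim R)
    then obtain r where r: "R \<le> r" "r \<le> 2 * R" and b: "\<And>z. norm z = r \<Longrightarrow> norm (\<phi> z) \<le> \<Lambda> R * exp (norm \<eta> * \<Lambda> R)"
      using K(2)[of R] by (auto simp: \<Lambda>_def mult.assoc)
    show ?case
      by (rule maximum_modulus_cball[OF \<phi>, of r]) (use r elim b in auto)
  qed
  then have "norm (\<phi> p) \<le> 0"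
    by (rule tendsto_lowerbound[OF lim]) simp
  then show False using \<phi>0 by simp
qed

section \<open>Counting a-points and clearing the poles at them\<close>

lemma finite_a_points:
  assumes "F z0 \<noteq> 0"
  shows "finite {z \<in> cball 0 T. F z = 0}"
proof (cases "F constant_on UNIV")
  case True
  then have "{z \<in> cball 0 T. F z = 0} = {}" using assms by (auto simp: constant_on_def)
  then show ?thesis by (metis finite.emptyI)
next
  case False
  show ?thesis
    by (rule holomorphic_compact_finite_zeros[OF F]) (use False in auto)
qed

text \<open>Each \<open>a\<close>-point \<open>\<alpha>\<close> starts a chain of zeros \<open>\<alpha> + j \<eta>\<close>, \<open>j \<ge> 1\<close>, and different \<open>a\<close>-points have
  disjoint chains, because no \<open>a\<close>-point lies on a chain.\<close>
lemma card_a_points_le: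
  assumes gr: "growth_le s f" and s: "0 \<le> s" and nz: "f 0 \<noteq> 0" "F 0 \<noteq> 0"
  obtains K where "0 \<le> K" "\<And>R. 1 \<le> R \<Longrightarrow> norm \<eta> \<le> R \<Longrightarrow>
    real (card {z \<in> cball 0 (3 * R). F z = 0}) \<le> K * R powr (s - 1)"
proof -
  obtain K where K: "0 \<le> K" "\<And>R. 1 \<le> R \<Longrightarrow> \<exists>zs. set zs = {z \<in> cball 0 (4 * R). f z = 0} \<and>
    real (length zs) \<le> K * R powr s"
    using growth_le_log_deriv_controlled_single[OF f gr nz(1) s] by blast
  show ?thesis
  proof (rule that[of "2 * norm \<eta> * K"])
    show "0 \<le> 2 * norm \<eta> * K" using K(1) by simp
    fix R :: real assume R: "1 \<le> R" "norm \<eta> \<le> R"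
    obtain zs where zs: "set zs = {z \<in> cball 0 (4 * R). f z = 0}" "real (length zs) \<le> K * R powr s"
      using K(2)[OF R(1)] by blast
    define A where "A = {z \<in> cball 0 (3 * R). F z = 0}"
    \<comment> \<open>The first \<open>k\<close> points of a chain lie within distance R of its
      a-point, hence in the disc of radius 4 R where zeros are counted. As R / |\<eta>| \<ge> 1,
      rounding down loses at most a factor 2; dividing the zero count by \<open>k\<close> gives the
      exponent s - 1.\<close>
    define k where "k = nat \<lfloor>R / norm \<eta>\<rfloor>"
    have \<eta>pos: "0 < norm \<eta>" using \<eta> by simp
    have one: "1 \<le> R / norm \<eta>" using R(2) \<eta>pos by simp
    have rk: "real k = of_int \<lfloor>R / norm \<eta>\<rfloor>" using one by (simp add: k_def)
    have "1 \<le> \<lfloor>R / norm \<eta>\<rfloor>" using one by (simp add: le_floor_iff)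
    then have "1 \<le> real k" unfolding rk by simp
    moreover have "R / norm \<eta> < real k + 1" unfolding rk by (rule real_of_int_floor_add_one_gt)
    ultimately have k1: "R / norm \<eta> \<le> 2 * real k" by linarith
    have k2: "real k \<le> R / norm \<eta>" unfolding rk by (rule of_int_floor_le)
    \<comment> \<open>\<open>Suc j\<close> rather than j: the a-point itself is not a zero of f,
      because a is nonzero.\<close>
    define c where "c = (\<lambda>(\<alpha>, j). \<alpha> + of_nat (Suc j) * \<eta>)"
    have "inj_on c (A \<times> {..<k})"
    proof -
      have False if "\<alpha> \<in> A" "\<beta> \<in> A" "i < j" "c (\<alpha>, i) = c (\<beta>, j)" for \<alpha> \<beta> i j
      proof -
        obtain m where m: "j = i + Suc m" using \<open>i < j\<close> less_imp_Suc_add by auto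
        have "\<alpha> = \<beta> + of_nat (Suc m) * \<eta>" using that(4) by (simp add: c_def m algebra_simps)
        then have "f \<alpha> = 0" using f_zero_after_a[of \<beta> m] that(2) by (simp add: A_def F_def)
        then show False using that(1) a by (simp add: A_def F_def)
      qed
      note no_lt = this
      show ?thesis
      proof (rule inj_onI)
        fix x y assume xy: "x \<in> A \<times> {..<k}" "y \<in> A \<times> {..<k}" "c x = c y"
        obtain \<alpha> i \<beta> j where eqs: "x = (\<alpha>, i)" "y = (\<beta>, j)" by (cases x, cases y)
        have "i = j" using no_lt[of \<alpha> \<beta> i j] no_lt[of \<beta> \<alpha> j i] xy eqs by (cases i j rule: linorder_cases) auto
        then show "x = y" using xy(3) by (simp add: eqs c_def)
      qed
    qed
    moreover have "c ` (A \<times> {..<k}) \<subseteq> set zs"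
    proof (rule image_subsetI)
      fix x assume "x \<in> A \<times> {..<k}"
      then obtain \<alpha> j where x: "x = (\<alpha>, j)" and \<alpha>: "\<alpha> \<in> A" and j: "j \<in> {..<k}" by auto
      have "norm (of_nat (Suc j) * \<eta>) \<le> real k * norm \<eta>"
        unfolding norm_mult norm_of_nat using j by (intro mult_right_mono) auto
      also have "\<dots> \<le> R" using k2 \<eta>pos by (simp add: le_divide_eq)
      finally have "norm (\<alpha> + of_nat (Suc j) * \<eta>) \<le> 4 * R"
        using \<alpha> norm_triangle_ineq[of \<alpha> "of_nat (Suc j) * \<eta>"] by (simp add: A_def)
      moreover have "f (\<alpha> + of_nat (Suc j) * \<eta>) = 0"
        using f_zero_after_a[of \<alpha> j] \<alpha> by (simp add: A_def F_def)
      ultimately show "c x \<in> set zs" by (simp add: x zs(1) c_def)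
    qed
    ultimately have "card (A \<times> {..<k}) \<le> card (set zs)" by (intro card_inj_on_le) auto
    also have "\<dots> \<le> length zs" by (rule card_length)
    finally have "real (card A) * real k \<le> K * R powr s"
      using zs(2) by (simp add: card_cartesian_product flip: of_nat_mult)
    moreover have "real (card A) * (R / norm \<eta>) \<le> real (card A) * (2 * real k)"
      by (intro mult_left_mono k1) auto
    ultimately have "real (card A) * (R / norm \<eta>) \<le> 2 * (K * R powr s)" by linarith
    then have "real (card A) * R \<le> 2 * norm \<eta> * K * R powr s"
      using \<eta>pos by (simp add: field_simps)
    moreover have "R powr s = R powr (s - 1) * R" using R(1) by (simp add: powr_diff)
    ultimately have "real (card A) * R \<le> (2 * norm \<eta> * K * R powr (s - 1)) * R" by (simp add: mult.assoc)
    then show "real (card {z \<in> cball 0 (3 * R). F z = 0}) \<le> 2 * norm \<eta> * K * R powr (s - 1)"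
      using R(1) by (simp add: A_def)
  qed
qed

text \<open>\<open>P\<close> is a common denominator of \<open>u\<close> and \<open>v\<close> on the
  disc. The condition P 0 = 1 makes the values at 0 of the quotients formed later independent of T.
  Bounds for two derivatives are included because the elimination differentiates the
  relation.\<close>

definition "clears_poles T B P U V \<longleftrightarrow>
  P holomorphic_on ball 0 T \<and> U holomorphic_on ball 0 T \<and> V holomorphic_on ball 0 T \<and> P 0 = 1 \<and>
  (\<forall>z\<in>ball 0 T. deriv f z * P z = U z * F z \<and> deriv G z * P z = V z * G z \<and>
    norm (P z) \<le> B \<and> norm (U z) \<le> B \<and> norm (V z) \<le> B \<and> norm (\<phi> z * P z) \<le> B \<and>
    norm (deriv U z) \<le> B \<and> norm (deriv (\<lambda>z. \<phi> z * P z) z) \<le> B)"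

text \<open>\<open>P\<close> has a zero at each \<open>a\<close>-point in the disc, so it turns \<open>u\<close> and \<open>v\<close> into holomorphic functions
  \<open>U = u P\<close> and \<open>V = v P\<close>; it has few zeros, whence the small bound.\<close>
lemma small_family:
  assumes gr: "growth_le s f" and s: "1 \<le> s" and nz: "f 0 \<noteq> 0" "F 0 \<noteq> 0"
  obtains K where "0 \<le> K" "\<And>T. 1 \<le> T \<Longrightarrow> norm \<eta> \<le> T \<Longrightarrow> \<exists>P U V. clears_poles T (exp (K * T powr (s - 1 / 2))) P U V"
proof -
  have s0: "0 \<le> s" using s by simp
  obtain K1 where K1: "0 \<le> K1" "\<And>R. 1 \<le> R \<Longrightarrow> norm \<eta> \<le> R \<Longrightarrow> \<exists>r. R \<le> r \<and> r \<le> 2 * R \<and> (\<forall>z. norm z = r \<longrightarrow>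
      F z \<noteq> 0 \<and> G z \<noteq> 0 \<and> norm (deriv f z) \<le> norm (F z) * (K1 * R powr (s - 1) * (1 + ln R)) \<and>
      norm (deriv G z) \<le> norm (G z) * (K1 * R powr (s - 1) * (1 + ln R)) \<and>
      norm (\<phi> z) \<le> (K1 * R powr (s - 1) * (1 + ln R)) * exp (norm \<eta> * (K1 * R powr (s - 1) * (1 + ln R))))"
    by (rule good_circles[OF gr s0 nz]) blast
  obtain K2 where K2: "0 \<le> K2" "\<And>R. 1 \<le> R \<Longrightarrow> norm \<eta> \<le> R \<Longrightarrow>
    real (card {z \<in> cball 0 (3 * R). F z = 0}) \<le> K2 * R powr (s - 1)"
    by (rule card_a_points_le[OF gr s0 nz]) blast
  have "open {w. F w \<noteq> 0}" using open_nonzero[OF F] by simp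
  then obtain d where d: "0 < d" "ball 0 d \<subseteq> {w. F w \<noteq> 0}"
    using nz(2) by (metis (mono_tags, lifting) mem_Collect_eq open_contains_ball)
  have d_le: "d \<le> norm \<alpha>" if "F \<alpha> = 0" for \<alpha>
    using d(2) that by (force simp: not_le[symmetric])
  define Kd where "Kd = ln (1 + 2 / d) + 1"
  have lnd: "0 \<le> ln (1 + 2 / d)" using d(1) by (intro ln_ge_zero) simp
  define M where "M = (1 + norm \<eta>) * K1 + K2 * Kd"
  have M: "0 \<le> M" using K1(1) K2(1) lnd by (simp add: M_def Kd_def)
  define K where "K = 2 * M * 2 powr (s - 1 / 2)"
  have K: "0 \<le> K" using M by (simp add: K_def)
  show ?thesis
  proof (rule that[of "K + 1"])
    show "0 \<le> K + 1" using K by simp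
    fix T :: real assume T: "1 \<le> T" "norm \<eta> \<le> T"
    \<comment> \<open>The circles then have radius at least 2 T, which leaves room for discs of
      radius T about every point of the disc |z| < T in the Cauchy estimate.\<close>
    define R where "R = 2 * T"
    have R: "1 \<le> R" "norm \<eta> \<le> R" "0 < R" "T < R" using T by (auto simp: R_def)
    have lnR: "0 \<le> ln R" using R by simp
    define x where "x = R powr (s - 1) * (1 + ln R)"
    have x0: "0 \<le> x" using lnR by (simp add: x_def)
    define \<Lambda> where "\<Lambda> = K1 * R powr (s - 1) * (1 + ln R)"
    have \<Lambda>x: "\<Lambda> = K1 * x" by (simp add: \<Lambda>_def x_def)
    have \<Lambda>0: "0 \<le> \<Lambda>" using K1(1) x0 by (simp add: \<Lambda>x)
    obtain r where r: "R \<le> r" "r \<le> 2 * R" and circ: "\<And>z. norm z = r \<Longrightarrow>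
      F z \<noteq> 0 \<and> G z \<noteq> 0 \<and> norm (deriv f z) \<le> norm (F z) * \<Lambda> \<and> norm (deriv G z) \<le> norm (G z) * \<Lambda> \<and>
      norm (\<phi> z) \<le> \<Lambda> * exp (norm \<eta> * \<Lambda>)"
      using K1(2)[OF R(1,2)] unfolding \<Lambda>_def by blast
    define A where "A = {z \<in> cball 0 (3 * R). F z = 0}"
    have finA: "finite A" unfolding A_def by (rule finite_a_points[OF nz(2)])
    have A0: "\<alpha> \<noteq> 0" "d \<le> norm \<alpha>" if "\<alpha> \<in> A" for \<alpha>
      using that nz(2) d_le by (auto simp: A_def)
    have cardA: "real (card A) \<le> K2 * R powr (s - 1)" unfolding A_def by (rule K2(2)[OF R(1,2)])
    \<comment> \<open>Simple zeros at the distinct a-points suffice, since only logarithmic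
      derivatives are multiplied by \<open>P\<close>. All a-points have modulus at least
      \<open>d\<close>, so each factor is at most 1 + 2 R / d for |z| \<le> 2 R.\<close>
    define P where "P = (\<lambda>z. \<Prod>\<alpha>\<in>A. 1 - z / \<alpha>)"
    have P: "P holomorphic_on UNIV" unfolding P_def using A0 by (intro holomorphic_intros) auto
    define S where "S = ball (0::complex) (3 * R)"
    have S: "open S" "connected S" "0 \<in> S" "cball 0 r \<subseteq> S" "ball 0 T \<subseteq> S"
      using r R by (auto simp: S_def)
    have P_zero: "P z = 0" if "z \<in> S" "F z = 0" for z
    proof -
      have "z \<in> A" using that by (auto simp: A_def S_def)
      then show ?thesis using finA A0 by (auto simp: P_def prod_zero_iff)
    qed
    have FS: "F holomorphic_on S" "G holomorphic_on S" "P holomorphic_on S" "\<phi> holomorphic_on S"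
      using F G P \<phi> by (auto intro: holomorphic_on_subset)
    have G0: "G 0 \<noteq> 0" using nz(2) G_zero_iff by simp
    obtain U where U: "U holomorphic_on S" "\<And>z. z \<in> S \<Longrightarrow> deriv F z * P z = U z * F z"
      by (rule holomorphic_log_deriv_times[OF FS(1,3) S(1-3) nz(2) P_zero]) auto
    obtain V where V: "V holomorphic_on S" "\<And>z. z \<in> S \<Longrightarrow> deriv G z * P z = V z * G z"
      by (rule holomorphic_log_deriv_times[OF FS(2,3) S(1-3) G0]) (use P_zero G_zero_iff in auto)
    define p where "p = K2 * Kd * x"
    have P_le: "norm (P z) \<le> exp p" if z: "norm z \<le> 2 * R" for z
    proof -
      have "norm (1 - z / \<alpha>) \<le> 1 + 2 * R / d" if "\<alpha> \<in> A" for \<alpha>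
      proof -
        have "norm (1 - z / \<alpha>) \<le> 1 + norm z / norm \<alpha>"
          using norm_triangle_ineq4[of 1 "z / \<alpha>"] by (simp add: norm_divide)
        also have "norm z / norm \<alpha> \<le> 2 * R / d"
          using z A0[OF that] d(1) R by (intro frac_le) auto
        finally show ?thesis by simp
      qed
      then have "norm (P z) \<le> (\<Prod>\<alpha>\<in>A. 1 + 2 * R / d)"
        unfolding P_def prod_norm[symmetric] by (intro prod_mono) auto
      also have "\<dots> = exp (real (card A) * ln (1 + 2 * R / d))"
        using d(1) R by (simp add: exp_of_nat_mult add_pos_pos)
      also have "\<dots> \<le> exp p"
      proof -
        have "ln (1 + 2 * R / d) \<le> ln ((1 + 2 / d) * R)"
          using d(1) R by (intro ln_mono) (auto simp: field_simps)
        also have "\<dots> = ln (1 + 2 / d) + ln R" using d(1) R by (intro ln_mult_pos) (auto intro: add_pos_pos)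
        also have "\<dots> \<le> Kd * (1 + ln R)"
          using lnd lnR by (simp add: Kd_def algebra_simps)
        finally have "real (card A) * ln (1 + 2 * R / d) \<le> (K2 * R powr (s - 1)) * (Kd * (1 + ln R))"
          using d(1) R K2(1) by (intro mult_mono cardA) auto
        then show ?thesis by (simp add: p_def x_def mult_ac)
      qed
      finally show ?thesis .
    qed
    define B where "B = exp (M * x)"
    have Mx: "M * x = \<Lambda> + norm \<eta> * \<Lambda> + p" by (simp add: M_def p_def \<Lambda>x algebra_simps)
    have p0: "0 \<le> p" using K2(1) lnd x0 by (simp add: p_def Kd_def)
    have eta\<Lambda>: "0 \<le> norm \<eta> * \<Lambda>" using \<Lambda>0 by simp
    have \<Lambda>_exp: "\<Lambda> \<le> exp \<Lambda>" using exp_ge_add_one_self[of \<Lambda>] by linarith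
    \<comment> \<open>A common bound for \<open>U\<close> and \<open>V\<close> on the good circle.
      The maximum principle carries it inside, where \<open>u\<close> and \<open>v\<close>
      themselves may have poles.\<close>
    have log_deriv_le: "norm (U z) \<le> B"
      if "h' * P z = U z * h z" "h z \<noteq> 0" "norm h' \<le> norm (h z) * \<Lambda>" "norm z = r" for U h :: "complex \<Rightarrow> complex" and h' z
    proof -
      have "norm (U z) * norm (h z) = norm h' * norm (P z)"
        using arg_cong[OF that(1), of norm] by (simp add: norm_mult)
      also have "\<dots> \<le> (norm (h z) * \<Lambda>) * exp p"
        using P_le[of z] that(3,4) r(2) \<Lambda>0 by (intro mult_mono) auto
      finally have "norm (U z) * norm (h z) \<le> (\<Lambda> * exp p) * norm (h z)" by (simp add: mult_ac)
      then have "norm (U z) \<le> \<Lambda> * exp p" using that(2) by simp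
      also have "\<dots> \<le> exp \<Lambda> * exp p" using \<Lambda>_exp by simp
      also have "\<dots> \<le> B" using eta\<Lambda> by (simp add: B_def Mx flip: exp_add)
      finally show ?thesis .
    qed
    have U_le: "norm (U z) \<le> B" if "norm z \<le> r" for z
    proof (rule maximum_modulus_cball[OF U(1) S(4) _ _ that])
      fix z :: complex assume z: "norm z = r"
      then have "z \<in> S" using S(4) by auto
      then show "norm (U z) \<le> B"
        using log_deriv_le[of "deriv f z" z U F] U(2)[of z] circ[OF z] z by (simp add: deriv_F)
    qed (use R r in auto)
    have V_le: "norm (V z) \<le> B" if "norm z \<le> r" for z
    proof (rule maximum_modulus_cball[OF V(1) S(4) _ _ that])
      fix z :: complex assume z: "norm z = r"
      then have "z \<in> S" using S(4) by auto
      then show "norm (V z) \<le> B"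
        using log_deriv_le[of "deriv G z" z V G] V(2)[of z] circ[OF z] z by simp
    qed (use R r in auto)
    define \<psi> where "\<psi> = (\<lambda>z. \<phi> z * P z)"
    have \<psi>: "\<psi> holomorphic_on S" unfolding \<psi>_def by (intro holomorphic_intros FS)
    have \<psi>_le: "norm (\<psi> z) \<le> B" if "norm z \<le> r" for z
    proof (rule maximum_modulus_cball[OF \<psi> S(4) _ _ that])
      fix z :: complex assume z: "norm z = r"
      have "norm (\<psi> z) \<le> (\<Lambda> * exp (norm \<eta> * \<Lambda>)) * exp p"
        unfolding \<psi>_def norm_mult using circ[OF z] P_le[of z] z r(2) \<Lambda>0 by (intro mult_mono) auto
      also have "\<dots> \<le> (exp \<Lambda> * exp (norm \<eta> * \<Lambda>)) * exp p"
        using \<Lambda>_exp by (intro mult_right_mono) auto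
      also have "\<dots> = B" by (simp add: B_def Mx flip: exp_add)
      finally show "norm (\<psi> z) \<le> B" .
    qed (use R r in auto)
    have P_le_B: "norm (P z) \<le> B" if "norm z \<le> r" for z
    proof -
      have "exp p \<le> B" using \<Lambda>0 eta\<Lambda> by (simp add: B_def Mx)
      then show ?thesis using P_le[of z] that r by linarith
    qed
    define E where "E = exp ((K + 1) * T powr (s - 1 / 2))"
    \<comment> \<open>The factor 2 is needed for the open ball in the Cauchy estimate. It is
      absorbed by enlarging K by 1, because T^(s - 1/2) \<ge> 1.\<close>
    have BE: "2 * B \<le> E"
    proof -
      have "M * x \<le> M * (2 * R powr (s - 1 / 2))"
        unfolding x_def by (intro mult_left_mono powr_ln_le R M)
      also have "\<dots> = K * T powr (s - 1 / 2)" by (simp add: K_def R_def powr_mult)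
      finally have "B \<le> exp (K * T powr (s - 1 / 2))" by (simp add: B_def)
      moreover have "2 \<le> exp (T powr (s - 1 / 2))"
        using exp_ge_add_one_self[of "T powr (s - 1 / 2)"] ge_one_powr_ge_zero[of T "s - 1 / 2"] T s by linarith
      ultimately have "B * 2 \<le> exp (K * T powr (s - 1 / 2)) * exp (T powr (s - 1 / 2))"
        by (intro mult_mono) auto
      then show ?thesis by (simp add: E_def distrib_right exp_add)
    qed
    have Bpos: "0 < B" by (simp add: B_def)
    have deriv_le: "norm (deriv h z) \<le> E"
      if h: "h holomorphic_on S" "\<And>z. norm z \<le> r \<Longrightarrow> norm (h z) \<le> B" and z: "norm z < T" for h z
    proof -
      have sub: "norm w < R" if "w \<in> cball z T" for w
        using that z norm_triangle_ineq2[of w z] by (simp add: dist_norm norm_minus_commute R_def)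
      have hz: "h holomorphic_on cball z T"
        by (rule holomorphic_on_subset[OF h(1)]) (use sub R in \<open>fastforce simp: S_def\<close>)
      have "norm ((deriv ^^ 1) h z) \<le> fact 1 * (2 * B) / T ^ 1"
      proof (rule Cauchy_higher_deriv_bound[where y = 0])
        show "h holomorphic_on ball z T" using hz by (rule holomorphic_on_subset) auto
        show "continuous_on (cball z T) h" using hz by (rule holomorphic_on_imp_continuous_on)
        fix w assume "w \<in> ball z T"
        then have "norm (h w) \<le> B" using sub[of w] r(1) by (intro h(2)) auto
        then show "h w \<in> ball 0 (2 * B)" using Bpos by simp
      qed (use T in auto)
      also have "\<dots> \<le> 2 * B" using T(1) Bpos by (simp add: divide_le_eq)
      finally show ?thesis using BE by simp
    qed
    have "clears_poles T E P U V"
      unfolding clears_poles_def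
    proof (intro conjI ballI)
      show "P holomorphic_on ball 0 T" "U holomorphic_on ball 0 T" "V holomorphic_on ball 0 T"
        using FS U V S(5) by (auto intro: holomorphic_on_subset)
      show "P 0 = 1" by (simp add: P_def)
      fix z :: complex assume z: "z \<in> ball 0 T"
      then have zS: "z \<in> S" and zr: "norm z \<le> r" "norm z < T" using R r S(5) by auto
      show "deriv f z * P z = U z * F z" "deriv G z * P z = V z * G z"
        using U(2)[OF zS] V(2)[OF zS] by (simp_all add: deriv_F)
      show "norm (P z) \<le> E" "norm (U z) \<le> E" "norm (V z) \<le> E" "norm (\<phi> z * P z) \<le> E"
        using P_le_B[OF zr(1)] U_le[OF zr(1)] V_le[OF zr(1)] \<psi>_le[OF zr(1)] BE Bpos
        unfolding \<psi>_def by linarith+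
      show "norm (deriv U z) \<le> E" by (rule deriv_le[OF U(1) U_le zr(2)])
      show "norm (deriv (\<lambda>z. \<phi> z * P z) z) \<le> E"
        using deriv_le[OF \<psi> \<psi>_le zr(2)] unfolding \<psi>_def .
    qed
    then show "\<exists>P U V. clears_poles T (exp ((K + 1) * T powr (s - 1 / 2))) P U V"
      unfolding E_def by blast
  qed
qed

section \<open>Two ways to express F as a quotient of functions of lower growth\<close>

text \<open>Elimination with U, V and \<phi> P in place of u, v and \<phi> gives X = F Y with
  holomorphic X and Y that are cubic in functions of lower growth.\<close>

lemma growth_le_F_of_D_nonzero:
  assumes gr: "growth_le s f" and s: "1 \<le> s" and nz: "f 0 \<noteq> 0" "F 0 \<noteq> 0" and D: "D 0 \<noteq> 0"
  shows "growth_le (s - 1 / 2) F"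
proof -
  obtain K where K: "0 \<le> K" "\<And>T. 1 \<le> T \<Longrightarrow> norm \<eta> \<le> T \<Longrightarrow> \<exists>P U V. clears_poles T (exp (K * T powr (s - 1 / 2))) P U V"
    by (rule small_family[OF gr s nz]) blast
  have G0: "G 0 \<noteq> 0" using nz(2) G_zero_iff by simp
  show ?thesis
  proof (rule growth_le_quotient[OF F _ D, of _ "3 * K + (8 + 3 * norm a)" "max 1 (norm \<eta>)"])
    fix T assume "max 1 (norm \<eta>) \<le> T"
    then have T: "1 \<le> T" "norm \<eta> \<le> T" by auto
    obtain P U V where cp: "clears_poles T (exp (K * T powr (s - 1 / 2))) P U V"
      using K(2)[OF T] by blast
    note cp = cp[unfolded clears_poles_def]
    have holo: "P holomorphic_on ball 0 T" "U holomorphic_on ball 0 T" "V holomorphic_on ball 0 T"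
      and P0: "P 0 = 1" using cp by simp_all
    have U: "deriv f z * P z = U z * F z" and V: "deriv G z * P z = V z * G z" if "z \<in> ball 0 T" for z
      using cp that by simp_all
    have sub: "F holomorphic_on ball 0 T" "G holomorphic_on ball 0 T" "\<phi> holomorphic_on ball 0 T"
      using F G \<phi> by (auto intro: holomorphic_on_subset)
    define \<psi> where "\<psi> = (\<lambda>z. \<phi> z * P z)"
    have \<psi>: "\<psi> holomorphic_on ball 0 T" unfolding \<psi>_def by (intro holomorphic_intros sub holo)
    note dh = holomorphic_deriv[OF _ open_ball]
    define X where "X = (\<lambda>z. a * (U z * P z * deriv \<psi> z - (deriv U z * P z + U z * V z) * \<psi> z))"
    define Y where "Y = (\<lambda>z. (deriv U z * P z + U z * V z - (U z)\<^sup>2) * (\<psi> z - U z)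
        - U z * P z * (deriv \<psi> z - deriv U z))"
    have XFY: "X z = F z * Y z" if z: "z \<in> ball 0 T" for z
      unfolding X_def Y_def
    proof (rule eliminate_second_function[OF open_ball sub(1,2) holo(2) \<psi> _ V _ z, symmetric])
      show "deriv F w * P w = U w * F w" if "w \<in> ball 0 T" for w using U[OF that] by (simp add: deriv_F)
      show "U w * G w = (\<psi> w - U w) * F w + a * \<psi> w" if "w \<in> ball 0 T" for w
        unfolding \<psi>_def using T nz(2) by (intro relation[OF _ _ _ _ holo(2,1) U that, of 0]) auto
    qed
    define e where "e = exp (K * T powr (s - 1 / 2))"
    have e1: "1 \<le> e" using K(1) by (simp add: e_def)
    have Ts: "1 \<le> T powr (s - 1 / 2)" using T(1) s by (intro ge_one_powr_ge_zero) auto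
    \<comment> \<open>The constants count monomials: X is bounded by 3 |a| e^3 and Y by 8 e^3. Both
      are absorbed into the exponential since T^(s - 1/2) \<ge> 1.\<close>
    have cube: "c * e ^ 3 \<le> exp ((3 * K + (8 + 3 * norm a)) * T powr (s - 1 / 2))"
      if c: "0 \<le> c" "c \<le> 8 + 3 * norm a" for c
    proof -
      have "c \<le> exp c" using exp_ge_add_one_self[of c] by linarith
      also have "c \<le> (8 + 3 * norm a) * T powr (s - 1 / 2)"
        using mult_mono[OF c(2) Ts] c by simp
      finally have "c \<le> exp ((8 + 3 * norm a) * T powr (s - 1 / 2))" by simp
      then have "c * e ^ 3 \<le> exp ((8 + 3 * norm a) * T powr (s - 1 / 2)) * e ^ 3"
        using e1 by (intro mult_right_mono) auto
      moreover have "e ^ 3 = exp (3 * (K * T powr (s - 1 / 2)))"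
        using exp_of_nat_mult[of 3 "K * T powr (s - 1 / 2)"] by (simp add: e_def)
      then have "exp ((8 + 3 * norm a) * T powr (s - 1 / 2)) * e ^ 3
          = exp ((3 * K + (8 + 3 * norm a)) * T powr (s - 1 / 2))"
        by (simp only: exp_add[symmetric] distrib_right mult.assoc add.commute)
      ultimately show ?thesis by simp
    qed
    show "\<exists>X Y. X holomorphic_on ball 0 T \<and> Y holomorphic_on ball 0 T \<and> Y 0 = D 0 \<and>
      (\<forall>z\<in>ball 0 T. X z = F z * Y z \<and> norm (X z) \<le> exp ((3 * K + (8 + 3 * norm a)) * T powr (s - 1 / 2)) \<and>
        norm (Y z) \<le> exp ((3 * K + (8 + 3 * norm a)) * T powr (s - 1 / 2)))"
    proof (rule exI[of _ X], rule exI[of _ Y], intro conjI ballI)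
      show "X holomorphic_on ball 0 T" unfolding X_def by (intro holomorphic_intros holo \<psi> dh)
      show "Y holomorphic_on ball 0 T" unfolding Y_def by (intro holomorphic_intros holo \<psi> dh)
      \<comment> \<open>Where F is nonzero the terms with P' cancel and Y = P^3 D. At 0 this is D 0,
        because P 0 = 1.\<close>
      show "Y 0 = D 0"
      proof -
        have "open {w. F w \<noteq> 0}" using open_nonzero[OF F] by simp
        then have oS: "open ({w. F w \<noteq> 0} \<inter> ball 0 T)" by (intro open_Int) auto
        have S0: "0 \<in> {w. F w \<noteq> 0} \<inter> ball 0 T" using nz(2) T by simp
        have uh: "u holomorphic_on {w. F w \<noteq> 0} \<inter> ball 0 T"
          unfolding u_def using oS
          by (intro holomorphic_intros holomorphic_deriv holomorphic_on_subset[OF f] holomorphic_on_subset[OF F]) auto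
        have du: "(u has_field_derivative deriv u 0) (at 0)"
          by (rule holomorphic_derivI[OF uh oS S0])
        have dP: "(P has_field_derivative deriv P 0) (at 0)"
          by (rule holomorphic_derivI[OF holo(1) open_ball]) (use T in auto)
        have d\<phi>: "(\<phi> has_field_derivative deriv \<phi> 0) (at 0)"
          by (rule holomorphic_derivI[OF \<phi> open_UNIV]) auto
        have "((\<lambda>z. u z * P z) has_field_derivative deriv u 0 * P 0 + deriv P 0 * u 0) (at 0)"
          by (rule DERIV_mult[OF du dP])
        then have "(U has_field_derivative deriv u 0 * P 0 + deriv P 0 * u 0) (at 0)"
          by (rule has_field_derivative_transform_within_open[OF _ oS S0])
             (use U in \<open>auto simp: u_def field_simps\<close>)
        then have dU: "deriv U 0 = deriv u 0 + deriv P 0 * u 0" by (simp add: DERIV_imp_deriv P0)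
        have "(\<psi> has_field_derivative deriv \<phi> 0 * P 0 + deriv P 0 * \<phi> 0) (at 0)"
          unfolding \<psi>_def by (rule DERIV_mult[OF d\<phi> dP])
        then have d\<psi>: "deriv \<psi> 0 = deriv \<phi> 0 + deriv P 0 * \<phi> 0" by (simp add: DERIV_imp_deriv P0)
        have U0: "U 0 = u 0" using U[of 0] nz(2) T P0 by (simp add: u_def field_simps)
        have V0: "V 0 = v 0" using V[of 0] G0 T P0 by (simp add: v_def field_simps)
        have \<psi>0: "\<psi> 0 = \<phi> 0" by (simp add: \<psi>_def P0)
        show ?thesis unfolding Y_def D_def dU d\<psi> U0 V0 \<psi>0 P0 by algebra
      qed
      fix z :: complex assume z: "z \<in> ball 0 T"
      show "X z = F z * Y z" by (rule XFY[OF z])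
      have b: "norm (P z) \<le> e" "norm (U z) \<le> e" "norm (V z) \<le> e" "norm (\<psi> z) \<le> e"
        "norm (deriv U z) \<le> e" "norm (deriv \<psi> z) \<le> e"
        using cp z unfolding e_def \<psi>_def by simp_all
      have m2: "norm (x * y) \<le> p * q" if "norm x \<le> p" "norm y \<le> q" for x y :: complex and p q
        unfolding norm_mult using that by (intro mult_mono) (auto intro: order_trans[OF norm_ge_zero])
      have a2: "norm (x + y) \<le> p + q" "norm (x - y) \<le> p + q" if "norm x \<le> p" "norm y \<le> q" for x y :: complex and p q
        using that norm_triangle_ineq[of x y] norm_triangle_ineq4[of x y] by linarith+
      have "norm (X z) \<le> norm a * (e * e * e + (e * e + e * e) * e)"
        unfolding X_def by (intro m2 a2 b order_refl)
      also have "\<dots> = (3 * norm a) * e ^ 3" by (simp add: power3_eq_cube algebra_simps)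
      also have "\<dots> \<le> exp ((3 * K + (8 + 3 * norm a)) * T powr (s - 1 / 2))"
        by (rule cube) auto
      finally show "norm (X z) \<le> exp ((3 * K + (8 + 3 * norm a)) * T powr (s - 1 / 2))" .
      have "norm (Y z) \<le> (e * e + e * e + e * e) * (e + e) + e * e * (e + e)"
        unfolding Y_def power2_eq_square by (intro m2 a2 b)
      also have "\<dots> = 8 * e ^ 3" by (simp add: power3_eq_cube algebra_simps)
      also have "\<dots> \<le> exp ((3 * K + (8 + 3 * norm a)) * T powr (s - 1 / 2))"
        by (rule cube) auto
      finally show "norm (Y z) \<le> exp ((3 * K + (8 + 3 * norm a)) * T powr (s - 1 / 2))" .
    qed
  qed (use K(1) s in auto)
qed

text \<open>The hypothesis says \<phi> = C u G, so U G can be replaced by \<psi> / C in the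
  undifferentiated relation. This leaves (1 / C - a) \<psi> = F (\<psi> - U), whose denominator has
  the value \<phi> 0 - u 0 at 0.\<close>

lemma growth_le_F_of_proportional:
  assumes gr: "growth_le s f" and s: "1 \<le> s" and nz: "f 0 \<noteq> 0" "F 0 \<noteq> 0"
    and C: "C \<noteq> 0" "\<And>z. F z * \<phi> z = C * deriv f z * G z" and W: "\<phi> 0 \<noteq> u 0"
  shows "growth_le (s - 1 / 2) F"
proof -
  obtain K where K: "0 \<le> K" "\<And>T. 1 \<le> T \<Longrightarrow> norm \<eta> \<le> T \<Longrightarrow> \<exists>P U V. clears_poles T (exp (K * T powr (s - 1 / 2))) P U V"
    by (rule small_family[OF gr s nz]) blast
  define c where "c = norm (1 / C - a)"
  have nzW: "\<phi> 0 - u 0 \<noteq> 0" using W by simp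
  show ?thesis
  proof (rule growth_le_quotient[OF F _ nzW, of _ "K + (2 + c)" "max 1 (norm \<eta>)"])
    fix T assume "max 1 (norm \<eta>) \<le> T"
    then have T: "1 \<le> T" "norm \<eta> \<le> T" by auto
    obtain P U V where cp: "clears_poles T (exp (K * T powr (s - 1 / 2))) P U V"
      using K(2)[OF T] by blast
    note cp = cp[unfolded clears_poles_def]
    have holo: "P holomorphic_on ball 0 T" "U holomorphic_on ball 0 T" and P0: "P 0 = 1"
      using cp by simp_all
    have U: "deriv f z * P z = U z * F z" if "z \<in> ball 0 T" for z
      using cp that by simp
    have sub: "F holomorphic_on ball 0 T" "G holomorphic_on ball 0 T" "\<phi> holomorphic_on ball 0 T"
      using F G \<phi> by (auto intro: holomorphic_on_subset)
    define \<psi> where "\<psi> = (\<lambda>z. \<phi> z * P z)"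
    have \<psi>: "\<psi> holomorphic_on ball 0 T" unfolding \<psi>_def by (intro holomorphic_intros sub holo)
    have UG: "\<psi> z = C * (U z * G z)" if z: "z \<in> ball 0 T" for z
    proof (rule holomorphic_cancel[where B = "\<lambda>z. C * (U z * G z)", OF sub(1) open_ball connected_ball _ nz(2) \<psi> _ _ z])
      show "F w * \<psi> w = F w * (C * (U w * G w))" if "w \<in> ball 0 T" for w
        using U[OF that] C(2)[of w] unfolding \<psi>_def by algebra
    qed (use T in \<open>auto intro!: holomorphic_intros \<psi> sub holo\<close>)
    have rel: "U z * G z = (\<psi> z - U z) * F z + a * \<psi> z" if "z \<in> ball 0 T" for z
      unfolding \<psi>_def using T nz(2) by (intro relation[OF _ _ _ _ holo(2,1) U that, of 0]) auto
    have eq: "(1 / C - a) * \<psi> z = F z * (\<psi> z - U z)" if z: "z \<in> ball 0 T" for z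
    proof -
      have "\<psi> z / C = U z * G z" using UG[OF z] C(1) by simp
      then show ?thesis using rel[OF z] by (simp add: algebra_simps)
    qed
    define e where "e = exp (K * T powr (s - 1 / 2))"
    have e1: "1 \<le> e" using K(1) by (simp add: e_def)
    have Ts: "1 \<le> T powr (s - 1 / 2)" using T(1) s by (intro ge_one_powr_ge_zero) auto
    have c0: "0 \<le> c" by (simp add: c_def)
    have mult_e: "t * e \<le> exp ((K + (2 + c)) * T powr (s - 1 / 2))" if t: "0 \<le> t" "t \<le> 2 + c" for t
    proof -
      have "t \<le> exp t" using exp_ge_add_one_self[of t] by linarith
      also have "t \<le> (2 + c) * T powr (s - 1 / 2)" using mult_mono[OF t(2) Ts] t by simp
      finally have "t \<le> exp ((2 + c) * T powr (s - 1 / 2))" by simp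
      then have "t * e \<le> exp ((2 + c) * T powr (s - 1 / 2)) * e" using e1 by (intro mult_right_mono) auto
      then show ?thesis by (simp add: e_def distrib_right exp_add mult_ac)
    qed
    show "\<exists>X Y. X holomorphic_on ball 0 T \<and> Y holomorphic_on ball 0 T \<and> Y 0 = \<phi> 0 - u 0 \<and>
      (\<forall>z\<in>ball 0 T. X z = F z * Y z \<and> norm (X z) \<le> exp ((K + (2 + c)) * T powr (s - 1 / 2)) \<and>
        norm (Y z) \<le> exp ((K + (2 + c)) * T powr (s - 1 / 2)))"
    proof (rule exI[of _ "\<lambda>z. (1 / C - a) * \<psi> z"], rule exI[of _ "\<lambda>z. \<psi> z - U z"], intro conjI ballI)
      show "(\<lambda>z. (1 / C - a) * \<psi> z) holomorphic_on ball 0 T" using C by (intro holomorphic_intros \<psi>)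
      show "(\<lambda>z. \<psi> z - U z) holomorphic_on ball 0 T" by (intro holomorphic_intros \<psi> holo)
      show "\<psi> 0 - U 0 = \<phi> 0 - u 0"
        using U[of 0] nz(2) T P0 by (simp add: u_def \<psi>_def field_simps)
      fix z :: complex assume z: "z \<in> ball 0 T"
      show "(1 / C - a) * \<psi> z = F z * (\<psi> z - U z)" by (rule eq[OF z])
      have b: "norm (U z) \<le> e" "norm (\<psi> z) \<le> e"
        using cp z unfolding e_def \<psi>_def by simp_all
      have "norm ((1 / C - a) * \<psi> z) \<le> c * e"
        unfolding norm_mult c_def using b by (intro mult_left_mono) auto
      also have "\<dots> \<le> exp ((K + (2 + c)) * T powr (s - 1 / 2))" by (rule mult_e) (use c0 in auto)
      finally show "norm ((1 / C - a) * \<psi> z) \<le> exp ((K + (2 + c)) * T powr (s - 1 / 2))" .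
      have "norm (\<psi> z - U z) \<le> 2 * e" using b norm_triangle_ineq4[of "\<psi> z" "U z"] by linarith
      also have "\<dots> \<le> exp ((K + (2 + c)) * T powr (s - 1 / 2))" by (rule mult_e) (use c0 in auto)
      finally show "norm (\<psi> z - U z) \<le> exp ((K + (2 + c)) * T powr (s - 1 / 2))" .
    qed
  qed (use K(1) s c_def in auto)
qed

text \<open>If \<open>D\<close> vanishes, then so does \<open>E\<close> in \<open>F D = a E\<close>, and \<open>E = 0\<close> says that \<open>\<phi> / (u G)\<close> is constant.\<close>
lemma proportional_of_D_zero:
  assumes D: "\<And>z. F z \<noteq> 0 \<Longrightarrow> D z = 0" and nz: "F p \<noteq> 0" "deriv f p \<noteq> 0" "\<phi> p \<noteq> 0"
  obtains C where "C \<noteq> 0" "\<And>z. F z * \<phi> z = C * deriv f z * G z"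
proof -
  define N where "N = {w. F w \<noteq> 0}"
  have oN: "open N" using open_nonzero[OF F] by (simp add: N_def)
  have sub: "F holomorphic_on N" "G holomorphic_on N" "\<phi> holomorphic_on N" "f holomorphic_on N"
    using F G \<phi> f by (auto intro: holomorphic_on_subset)
  have u: "u holomorphic_on N" unfolding u_def using oN
    by (intro holomorphic_intros holomorphic_deriv sub) (auto simp: N_def)
  have E: "u z * deriv \<phi> z - (deriv u z + u z * v z) * \<phi> z = 0" if z: "z \<in> N" for z
  proof -
    have "F z * ((deriv u z * 1 + u z * v z - (u z)\<^sup>2) * (\<phi> z - u z) - u z * 1 * (deriv \<phi> z - deriv u z))
      = a * (u z * 1 * deriv \<phi> z - (deriv u z * 1 + u z * v z) * \<phi> z)"
    proof (rule eliminate_second_function[OF oN sub(1,2) u sub(3) _ _ _ z])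
      fix w assume w: "w \<in> N"
      then have Fw: "F w \<noteq> 0" "G w \<noteq> 0" using G_zero_iff by (auto simp: N_def)
      show "deriv F w * 1 = u w * F w" using Fw by (simp add: u_def deriv_F)
      show "deriv G w * 1 = v w * G w" using Fw by (simp add: v_def)
      have "\<phi> w * (F w + a) * F w = deriv f w * (F w + G w)"
        using \<phi>_eq[of w] by (simp add: F_def G_def)
      moreover have "deriv f w = u w * F w" using Fw by (simp add: u_def)
      ultimately have "F w * (u w * G w) = F w * ((\<phi> w - u w) * F w + a * \<phi> w)" by algebra
      then show "u w * G w = (\<phi> w - u w) * F w + a * \<phi> w" using Fw by simp
    qed
    then have "a * (u z * deriv \<phi> z - (deriv u z + u z * v z) * \<phi> z) = F z * D z" by (simp add: D_def)
    then show ?thesis using D[of z] z a by (simp add: N_def)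
  qed
  have pN: "p \<in> N" using nz by (simp add: N_def)
  have up: "u p \<noteq> 0" using nz by (simp add: u_def)
  have "open (N \<inter> u -` (- {0}))"
    by (rule continuous_open_preimage[OF holomorphic_on_imp_continuous_on[OF u] oN]) (simp add: open_Compl)
  then obtain r where r: "0 < r" "ball p r \<subseteq> N \<inter> u -` (- {0})"
    using pN up by (metis ComplI IntI empty_iff insertE open_contains_ball vimageI2)
  have "\<exists>C. \<forall>z\<in>ball p r. \<phi> z / (u z * G z) = C"
  proof (rule has_field_derivative_zero_constant)
    fix z assume "z \<in> ball p r"
    then have z: "z \<in> N" "u z \<noteq> 0" "G z \<noteq> 0" using r G_zero_iff by (auto simp: N_def)
    have d\<phi>: "(\<phi> has_field_derivative deriv \<phi> z) (at z)"
      and du: "(u has_field_derivative deriv u z) (at z)" and dG: "(G has_field_derivative deriv G z) (at z)"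
      by (rule holomorphic_derivI[OF _ oN z(1)], rule sub u)+
    have "((\<lambda>z. \<phi> z / (u z * G z)) has_field_derivative
        (deriv \<phi> z * (u z * G z) - \<phi> z * (deriv u z * G z + deriv G z * u z)) / ((u z * G z) * (u z * G z))) (at z)"
      by (rule DERIV_divide[OF d\<phi> DERIV_mult[OF du dG]]) (use z in simp)
    \<comment> \<open>Since G' = v G, this numerator is G times the expression that \<open>E\<close>
      shows to be zero.\<close>
    moreover have "deriv \<phi> z * (u z * G z) - \<phi> z * (deriv u z * G z + deriv G z * u z) = 0"
    proof -
      have "deriv G z = v z * G z" using z(3) by (simp add: v_def)
      then show ?thesis using E[OF z(1)] by algebra
    qed
    ultimately show "((\<lambda>z. \<phi> z / (u z * G z)) has_field_derivative 0) (at z within ball p r)"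
      by (simp add: has_field_derivative_at_within)
  qed simp
  then obtain C where C: "\<And>z. z \<in> ball p r \<Longrightarrow> \<phi> z / (u z * G z) = C" by blast
  have Gp: "G p \<noteq> 0" using nz(1) G_zero_iff by simp
  show ?thesis
  proof (rule that)
    show "C \<noteq> 0" using C[of p] r(1) nz up Gp by auto
    have on_ball: "F z * \<phi> z = C * deriv f z * G z" if "z \<in> ball p r" for z
    proof -
      have z: "F z \<noteq> 0" "u z \<noteq> 0" "G z \<noteq> 0" using r G_zero_iff that by (auto simp: N_def)
      have "\<phi> z = C * (u z * G z)" using C[OF that] z by (simp add: field_simps)
      moreover have "deriv f z = u z * F z" using z by (simp add: u_def)
      ultimately show ?thesis by simp
    qed
    \<comment> \<open>Without denominators both sides are entire, so the identity theorem extends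
      the equation from the ball to the plane.\<close>
    show "F z * \<phi> z = C * deriv f z * G z" for z
      by (rule analytic_continuation_open[OF open_ball[of p r] open_UNIV _ connected_UNIV _ _ _ on_ball])
         (use r in \<open>auto intro!: holomorphic_intros F G \<phi> holomorphic_deriv f\<close>)
  qed
qed

section \<open>One step of the descent, and the contradiction\<close>

lemma F_nonzero_point:
  assumes nc: "f z1 \<noteq> f z2"
  obtains p where "F p \<noteq> 0"
proof -
  have "F z1 \<noteq> 0 \<or> F z2 \<noteq> 0" using nc by (auto simp: F_def)
  then show ?thesis using that by blast
qed

text \<open>The two cases differ in whether \<open>D\<close> vanishes wherever F does not. In each,
  f is translated so that the denominator in use is nonzero at 0; adding a to the translated-back F
  recovers f.\<close>

lemma growth_le_half_step:
  assumes gr: "growth_le s f" and s: "1 \<le> s" and nc: "f z1 \<noteq> f z2"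
    and g: "f (z3 + \<eta>) \<noteq> f z3"
  shows "growth_le (s - 1 / 2) f"
proof -
  have s': "0 \<le> s - 1 / 2" "0 \<le> s" using s by auto
  have from_F: "growth_le (s - 1 / 2) f"
    if "growth_le (s - 1 / 2) (shared_pairs.F a (\<lambda>z. f (z + p)))" for p
  proof -
    interpret T: shared_pairs \<eta> a "\<lambda>z. f (z + p)" "\<lambda>z. \<phi> (z + p)" by (rule translate)
    have "growth_le (s - 1 / 2) (\<lambda>z. T.F (z + (- p)) + a)"
      by (rule growth_le_add[OF s'(1) growth_le_shift[OF s'(1) that] growth_le_const[OF s'(1)]])
    then show ?thesis by (simp add: T.F_def)
  qed
  have deriv_shift: "deriv (\<lambda>z. h (z + p)) z = deriv h (z + p)" for h :: "complex \<Rightarrow> complex" and p z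
    by (simp only: deriv_def DERIV_shift)
  have pick: "\<exists>z\<in>U. h z \<noteq> 0"
    if "h holomorphic_on UNIV" "h w \<noteq> 0" "open U" "U \<noteq> {}" for h :: "complex \<Rightarrow> complex" and w U
    using entire_nonzero_in_open[OF that(1) open_UNIV connected_UNIV UNIV_I that(2-4)] by blast
  have open_nz: "open {z. h z \<noteq> 0}" if "h holomorphic_on UNIV" for h :: "complex \<Rightarrow> complex"
    using open_nonzero[OF that] by simp
  obtain p0 where p0: "F p0 \<noteq> 0" using nc by (rule F_nonzero_point)
  obtain q0 where q0: "f q0 \<noteq> 0" using nc by metis
  show ?thesis
  proof (cases "\<exists>p. F p \<noteq> 0 \<and> D p \<noteq> 0")
    case True
    then obtain p where p: "F p \<noteq> 0" "D p \<noteq> 0" by blast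
    define N where "N = {z. F z \<noteq> 0}"
    have oN: "open N" unfolding N_def by (rule open_nz[OF F])
    have GN: "G z \<noteq> 0" if "z \<in> N" for z using that G_zero_iff by (simp add: N_def)
    have sub: "F holomorphic_on N" "G holomorphic_on N" "\<phi> holomorphic_on N" "f holomorphic_on N"
      using F G \<phi> f by (auto intro: holomorphic_on_subset)
    have "u holomorphic_on N" unfolding u_def using oN
      by (intro holomorphic_intros holomorphic_deriv sub) (auto simp: N_def)
    moreover have "v holomorphic_on N" unfolding v_def using oN GN
      by (intro holomorphic_intros holomorphic_deriv sub) auto
    ultimately have Dh: "D holomorphic_on N" unfolding D_def using oN
      by (intro holomorphic_intros holomorphic_deriv sub)
    have oD: "open (N \<inter> D -` (- {0}))"
      by (rule continuous_open_preimage[OF holomorphic_on_imp_continuous_on[OF Dh] oN]) (simp add: open_Compl)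
    have "N \<inter> D -` (- {0}) \<noteq> {}" using p by (auto simp: N_def)
    then obtain c where c: "c \<in> N \<inter> D -` (- {0})" "f c \<noteq> 0" using pick[OF f q0 oD] by blast
    interpret T: shared_pairs \<eta> a "\<lambda>z. f (z + c)" "\<lambda>z. \<phi> (z + c)" by (rule translate)
    have TF: "T.F = (\<lambda>z. F (z + c))" by (simp add: T.F_def F_def fun_eq_iff)
    have TG: "T.G = (\<lambda>z. G (z + c))" by (simp add: T.G_def G_def fun_eq_iff add_ac)
    have Tu: "T.u = (\<lambda>z. u (z + c))" by (simp add: T.u_def u_def TF deriv_shift fun_eq_iff)
    have Tv: "T.v = (\<lambda>z. v (z + c))" by (simp add: T.v_def v_def TG deriv_shift fun_eq_iff)
    have TD: "T.D 0 = D c" by (simp add: T.D_def D_def Tu Tv deriv_shift)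
    have "growth_le (s - 1 / 2) T.F"
      by (rule T.growth_le_F_of_D_nonzero[OF growth_le_shift[OF s'(2) gr] s])
         (use c in \<open>auto simp: TF TD N_def\<close>)
    then show ?thesis by (rule from_F)
  next
    case False
    define g where "g = (\<lambda>z. f (z + \<eta>) - f z)"
    have gh: "g holomorphic_on UNIV" unfolding g_def by (intro holomorphic_intros f f_shift)
    have dfh: "deriv f holomorphic_on UNIV" by (rule holomorphic_deriv[OF f open_UNIV])
    have f1h: "(\<lambda>z. f (z + \<eta>)) holomorphic_on UNIV" by (rule f_shift)
    obtain w1 where w1: "deriv f w1 \<noteq> 0" by (rule nonconstant_deriv_nonzero[OF f nc])
    \<comment> \<open>Nonzero entire functions have a common point where none of them vanishes. The
      condition on \<open>g\<close> excludes \<phi> p = u p: with f' p nonzero, that equality would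
      give f (p + \<eta>) = f p.\<close>
    obtain p where p: "f p \<noteq> 0" "F p \<noteq> 0" "deriv f p \<noteq> 0" "g p \<noteq> 0" "f (p + \<eta>) \<noteq> 0"
    proof -
      have "{z. F z \<noteq> 0} \<noteq> {}" using p0 by blast
      then have n1: "{z. F z \<noteq> 0} \<inter> {z. f z \<noteq> 0} \<noteq> {}"
        using pick[OF f q0 open_nz[OF F]] by blast
      have o1: "open ({z. F z \<noteq> 0} \<inter> {z. f z \<noteq> 0})" by (intro open_Int open_nz F f)
      have n2: "{z. F z \<noteq> 0} \<inter> {z. f z \<noteq> 0} \<inter> {z. deriv f z \<noteq> 0} \<noteq> {}"
        using pick[OF dfh w1 o1 n1] by blast
      have o2: "open ({z. F z \<noteq> 0} \<inter> {z. f z \<noteq> 0} \<inter> {z. deriv f z \<noteq> 0})" by (intro open_Int open_nz F f dfh)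
      have g3: "g z3 \<noteq> 0" using g by (simp add: g_def)
      have n3: "{z. F z \<noteq> 0} \<inter> {z. f z \<noteq> 0} \<inter> {z. deriv f z \<noteq> 0} \<inter> {z. g z \<noteq> 0} \<noteq> {}"
        using pick[OF gh g3 o2 n2] by blast
      have o3: "open ({z. F z \<noteq> 0} \<inter> {z. f z \<noteq> 0} \<inter> {z. deriv f z \<noteq> 0} \<inter> {z. g z \<noteq> 0})"
        by (intro open_Int open_nz F f dfh gh)
      have "f ((q0 - \<eta>) + \<eta>) \<noteq> 0" using q0 by simp
      from pick[OF f1h this o3 n3] show ?thesis using that by blast
    qed
    have \<phi>p: "\<phi> p \<noteq> 0" using \<phi>_eq[of p] p by auto
    obtain C where C: "C \<noteq> 0" "\<And>z. F z * \<phi> z = C * deriv f z * G z"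
      by (rule proportional_of_D_zero[OF _ p(2,3) \<phi>p]) (use False in auto)
    interpret T: shared_pairs \<eta> a "\<lambda>z. f (z + p)" "\<lambda>z. \<phi> (z + p)" by (rule translate)
    have TF: "T.F = (\<lambda>z. F (z + p))" by (simp add: T.F_def F_def fun_eq_iff)
    have TG: "T.G = (\<lambda>z. G (z + p))" by (simp add: T.G_def G_def fun_eq_iff add_ac)
    have Tu: "T.u = (\<lambda>z. u (z + p))" by (simp add: T.u_def u_def TF deriv_shift fun_eq_iff)
    have "\<phi> p \<noteq> u p"
    proof
      assume "\<phi> p = u p"
      then have "\<phi> p * F p = deriv f p" using p(2) by (simp add: u_def)
      moreover have "(\<phi> p * F p) * f p = deriv f p * f (p + \<eta>)" using \<phi>_eq[of p] by (simp add: F_def mult_ac)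
      ultimately show False using p by (simp add: g_def)
    qed
    then have "growth_le (s - 1 / 2) T.F"
      by (intro T.growth_le_F_of_proportional[OF growth_le_shift[OF s'(2) gr] s _ _ C(1)])
         (use p C(2) in \<open>auto simp: TF TG Tu deriv_shift\<close>)
    then show ?thesis by (rule from_F)
  qed
qed

text \<open>Half-integers index the descent because each step lowers the exponent by 1/2. A step
  requires s \<ge> 1, that is, an exponent of at least 2/2; the values 0 and 1/2 are settled
  directly.\<close>

lemma not_growth:
  assumes gr: "growth_le (real m / 2) f" and nc: "f z1 \<noteq> f z2" and g: "f (z3 + \<eta>) \<noteq> f z3"
    and \<phi>nz: "\<phi> p \<noteq> 0"
  shows False
proof -
  obtain p0 where p0: "F p0 \<noteq> 0" using nc by (rule F_nonzero_point)
  obtain q0 where q0: "f q0 \<noteq> 0" using nc by metis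
  have "open (F -` (- {0}))"
    using continuous_open_preimage[OF holomorphic_on_imp_continuous_on[OF F] open_UNIV, of "- {0}"]
    by (simp add: open_Compl)
  then obtain c where c: "c \<in> F -` (- {0})" "f c \<noteq> 0"
    by (rule entire_nonzero_in_open[OF f open_UNIV connected_UNIV UNIV_I q0]) (use p0 in auto)
  interpret T: shared_pairs \<eta> a "\<lambda>z. f (z + c)" "\<lambda>z. \<phi> (z + c)" by (rule translate)
  have half: False if "growth_le (1 / 2) f"
    by (rule T.not_growth_half[OF growth_le_shift[OF _ that], where p = "p - c"])
       (use c \<phi>nz in \<open>auto simp: T.F_def F_def\<close>)
  show False
    using gr
  proof (induction m)
    case 0
    show ?case by (rule half[OF growth_le_mono[OF _ 0]]) simp
  next
    case (Suc m)
    show ?case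
    proof (cases "m = 0")
      case True
      then show ?thesis using half Suc.prems by simp
    next
      case False
      then have "growth_le (real (Suc m) / 2 - 1 / 2) f"
        by (intro growth_le_half_step[OF Suc.prems _ nc g]) auto
      moreover have "real (Suc m) / 2 - 1 / 2 = real m / 2" by (simp add: field_simps)
      ultimately have "growth_le (real m / 2) f" by metis
      then show ?thesis by (rule Suc.IH)
    qed
  qed
qed

end

section \<open>Construction of the auxiliary entire function, and conclusion\<close>

text \<open>Partial fractions: 1 / (f (f - a)) = (1 / (f - a) - 1 / f) / a. Hence \<phi> is a
  combination of two logarithmic derivatives, each multiplied by f (z + \<eta>), which vanishes at
  their poles. It is not identically 0, because neither f' nor the shifted f is.\<close>

lemma exists_auxiliary_function:
  assumes f: "f holomorphic_on UNIV" and a: "a \<noteq> 0" and nc: "f z1 \<noteq> f z2"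
    and share_0: "\<And>z. f z = 0 \<Longrightarrow> f (z + \<eta>) = 0" and share_a: "\<And>z. f z = a \<Longrightarrow> f (z + \<eta>) = 0"
  obtains \<phi> p where "\<phi> holomorphic_on UNIV" "\<phi> p \<noteq> 0"
    "\<And>z. \<phi> z * f z * (f z - a) = deriv f z * f (z + \<eta>)"
proof -
  have f1: "(\<lambda>z. f (z + \<eta>)) holomorphic_on UNIV"
    by (rule holomorphic_on_compose_gen[OF _ f, unfolded o_def]) (auto intro!: holomorphic_intros)
  have F: "(\<lambda>z. f z - a) holomorphic_on UNIV" by (intro holomorphic_intros f)
  have dF: "deriv (\<lambda>z. f z - a) z = deriv f z" for z
  proof -
    have "(f has_field_derivative deriv f z) (at z)" using holomorphic_derivI[OF f open_UNIV] by simp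
    then have "((\<lambda>z. f z - a) has_field_derivative deriv f z - 0) (at z)" by (intro DERIV_diff DERIV_const)
    then show ?thesis by (simp add: DERIV_imp_deriv)
  qed
  obtain p0 where p0: "f p0 \<noteq> 0" using nc by metis
  obtain q0 where q0: "f q0 - a \<noteq> 0" using nc by (metis right_minus_eq)
  obtain q1 where q1: "q1 holomorphic_on UNIV" "\<And>z. z \<in> UNIV \<Longrightarrow> deriv f z * f (z + \<eta>) = q1 z * f z"
    by (rule holomorphic_log_deriv_times[OF f f1 open_UNIV connected_UNIV UNIV_I p0]) (use share_0 in auto)
  obtain q2 where q2: "q2 holomorphic_on UNIV"
    "\<And>z. z \<in> UNIV \<Longrightarrow> deriv (\<lambda>z. f z - a) z * f (z + \<eta>) = q2 z * (f z - a)"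
    by (rule holomorphic_log_deriv_times[OF F f1 open_UNIV connected_UNIV UNIV_I q0]) (use share_a in auto)
  define \<phi> where "\<phi> = (\<lambda>z. (q2 z - q1 z) / a)"
  have \<phi>: "\<phi> holomorphic_on UNIV" unfolding \<phi>_def by (intro holomorphic_intros q1 q2) (use a in auto)
  have eq: "\<phi> z * f z * (f z - a) = deriv f z * f (z + \<eta>)" for z
  proof -
    have "a * \<phi> z = q2 z - q1 z" using a by (simp add: \<phi>_def)
    then have "a * (\<phi> z * f z * (f z - a)) = a * (deriv f z * f (z + \<eta>))"
      using q1(2)[OF UNIV_I, of z] q2(2)[OF UNIV_I, of z] unfolding dF by algebra
    then show ?thesis using a by simp
  qed
  obtain w where w: "deriv f w \<noteq> 0" by (rule nonconstant_deriv_nonzero[OF f nc])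
  have "\<exists>p. \<phi> p \<noteq> 0"
  proof (rule ccontr)
    assume "\<not> ?thesis"
    then have zero: "deriv f z * f (z + \<eta>) = deriv f z * 0" for z using eq[of z] by simp
    have "f (z + \<eta>) = 0" for z
      by (rule holomorphic_cancel[where A = "\<lambda>z. f (z + \<eta>)" and B = "\<lambda>_. 0",
            OF holomorphic_deriv[OF f open_UNIV] open_UNIV connected_UNIV UNIV_I w f1 _ zero UNIV_I]) simp
    from this[of "p0 - \<eta>"] show False using p0 by simp
  qed
  then show ?thesis using that[OF \<phi> _ eq] by blast
qed

theorem theorem9:
  fixes \<eta> a :: complex
  assumes "\<eta> \<noteq> 0" and "a \<noteq> 0"
  shows "\<not> (\<exists>f. f holomorphic_on UNIV \<and> nonconstant f \<and> order_entire f < \<infinity> \<and>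
              share_pair_IM f (diff_op \<eta> f) 0 0 \<and> share_pair_IM f (diff_op \<eta> f) a (- a))"
proof
  assume "\<exists>f. f holomorphic_on UNIV \<and> nonconstant f \<and> order_entire f < \<infinity> \<and>
              share_pair_IM f (diff_op \<eta> f) 0 0 \<and> share_pair_IM f (diff_op \<eta> f) a (- a)"
  then obtain f where f: "f holomorphic_on UNIV" and nonconst: "nonconstant f" and ord: "order_entire f < \<infinity>"
    and s0: "share_pair_IM f (diff_op \<eta> f) 0 0" and sa: "share_pair_IM f (diff_op \<eta> f) a (- a)"
    by blast
  obtain z1 z2 where nc: "f z1 \<noteq> f z2" using nonconst unfolding nonconstant_def by metis
  obtain z3 where "diff_op \<eta> f z3 \<noteq> 0" using s0 unfolding share_pair_IM_def nonconstant_def by blast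
  then have g: "f (z3 + \<eta>) \<noteq> f z3" by (simp add: diff_op_def)
  have "f z = 0 \<longleftrightarrow> diff_op \<eta> f z = 0" for z using s0 unfolding share_pair_IM_def by blast
  then have share_0: "f (z + \<eta>) = f z \<longleftrightarrow> f z = 0" for z by (simp add: diff_op_def)
  have "f z = a \<longleftrightarrow> diff_op \<eta> f z = - a" for z using sa unfolding share_pair_IM_def by blast
  moreover have "diff_op \<eta> f z = - a \<longleftrightarrow> f (z + \<eta>) = f z - a" for z
    unfolding diff_op_def by (auto simp: diff_eq_eq)
  ultimately have share_a: "f (z + \<eta>) = f z - a \<longleftrightarrow> f z = a" for z by blast
  \<comment> \<open>The value - a in the second pair is what makes this work: at an a-point the
    difference is - a, so the shifted value is a - a = 0.\<close>
  have zero_next: "f (z + \<eta>) = 0" if "f z = 0 \<or> f z = a" for z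
    using that share_0[of z] share_a[of z] by auto
  obtain \<phi> p where aux: "\<phi> holomorphic_on UNIV" "\<phi> p \<noteq> 0"
    "\<And>z. \<phi> z * f z * (f z - a) = deriv f z * f (z + \<eta>)"
    by (rule exists_auxiliary_function[OF f assms(2) nc]) (use zero_next in blast)+
  interpret shared_pairs \<eta> a f \<phi>
    by unfold_locales (rule f aux(1,3) assms share_0 share_a)+
  obtain p0 where "f p0 \<noteq> 0" using nc by metis
  then obtain n where "growth_le (real n) f" using growth_le_of_order_finite[OF f _ ord] by blast
  then have "growth_le (real (2 * n) / 2) f" by simp
  then show False using nc g aux(2) by (rule not_growth)
qed

end
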